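(* Suppose that $d\ge3$, $N\ge2$ are integers and $\beta$ is large enough (that is, for every such $d,N$ there is $\beta_0<\infty$ such that the following holds for all $\beta>\beta_0$). Then there exist $c_1,c_2>0$ such that for any $L\in2\mathbb N$ and any $x,y\in\mathbb T_L$ with $\|x-y\|_\infty\le c_2L$, $$\langle\varphi_x^1\varphi_x^2\varphi_y^1\varphi_y^2\rangle_{L,N,\beta}\ \ge\ c_1 .$$
   Context: $\mathbb T_L=\{x\in\mathbb Z^d:x_i\in(-L/2,L/2]\ \forall i\}$ is the $d$-dimensional torus of side length $L$ (coordinates modulo $L$) with nearest-neighbour edge set $\mathbb E_L$; $2\mathbb N$ is the set of positive even integers. Spin $O(N)$ model on the torus: spin configurations are $\varphi=(\varphi_x)_{x\in\mathbb T_L}$ with $\varphi_x=(\varphi_x^1,\dots,\varphi_x^N)\in\mathbb S^{N-1}\subset\mathbb R^N$ (unit sphere). The Hamiltonian is $H(\varphi)=-\sum_{\{x,y\}\in\mathbb E_L}\varphi_x\cdot\varphi_y$. For $\beta\ge0$ and $f:(\mathbb S^{N-1})^{\mathbb T_L}\to\mathbb R$, $$\langle f\rangle_{L,N,\beta}=\frac{\Big(\prod_{x\in\mathbb T_L}\int_{\mathbb S^{N-1}}d\varphi_x\Big)f(\varphi)e^{-\beta H(\varphi)}}{\Big(\prod_{x\in\mathbb T_L}\int_{\mathbb S^{N-1}}d\varphi_x\Big)e^{-\beta H(\varphi)}},$$ where $d\varphi_x$ is the uniform probability measure on $\mathbb S^{N-1}$. *)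

theory Defs
  imports "HOL-Probability.Probability" "HOL-Number_Theory.Cong"
begin

definition torus :: "nat \<Rightarrow> (int ^ 'd) set" where
  "torus L = {x. \<forall>i. - (real L / 2) < real_of_int (x $ i) \<and> real_of_int (x $ i) \<le> real L / 2}"

text \<open>Reduction modulo \<open>L\<close>: for \<open>L > 0\<close>, \<open>torus_rep L z\<close> is the unique element of \<open>torus L\<close>
  congruent to \<open>z\<close> (see below).\<close>

definition torus_rep :: "nat \<Rightarrow> int ^ 'd \<Rightarrow> int ^ 'd" where
  "torus_rep L z = (\<chi> i. int L div 2 - (int L div 2 - z $ i) mod int L)"

lemma torus_rep_in_torus:
  assumes "L > 0"
  shows "torus_rep L z \<in> torus L"
proof -
  have "- int L < 2 * (int L div 2 - (int L div 2 - a) mod int L)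
      \<and> 2 * (int L div 2 - (int L div 2 - a) mod int L) \<le> int L" for a :: int
  proof -
    define k m where "k = int L div 2" and "m = (k - a) mod int L"
    have "int L \<le> 2 * k + 1" "2 * k \<le> int L"
      by (simp_all add: k_def)
    moreover have "0 \<le> m" "m < int L"
      using assms by (simp_all add: m_def)
    ultimately show ?thesis
      by (simp flip: k_def m_def)
  qed
  then have "real_of_int (- int L) < real_of_int (2 * (torus_rep L z $ i))
      \<and> real_of_int (2 * (torus_rep L z $ i)) \<le> real_of_int (int L)" for i
    unfolding of_int_less_iff of_int_le_iff by (simp add: torus_rep_def)
  then show ?thesis
    by (simp add: torus_def field_simps)
qed

lemma torus_rep_cong: "[torus_rep L z $ i = z $ i] (mod int L)"
  by (simp add: torus_rep_def cong_def mod_diff_right_eq)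

lemma torus_cong_unique:
  assumes "x \<in> torus L" "y \<in> torus L" "\<And>i. [x $ i = y $ i] (mod int L)"
  shows "x = y"
proof (rule vec_eq_iff[THEN iffD2], rule allI)
  fix i
  have "\<bar>real_of_int (x $ i - y $ i)\<bar> < real_of_int (int L)"
    using assms(1,2) by (auto simp: torus_def dest!: spec[of _ i])
  then have "\<bar>x $ i - y $ i\<bar> < \<bar>int L\<bar>"
    by linarith
  moreover have "int L dvd x $ i - y $ i"
    using assms(3)[of i] by (simp add: cong_iff_dvd_diff)
  ultimately show "x $ i = y $ i"
    using dvd_imp_le_int[of "x $ i - y $ i" "int L"] by fastforce
qed

definition torus_edges :: "nat \<Rightarrow> (int ^ 'd) set set" where
  "torus_edges L = {{x, torus_rep L (x + axis i 1)} | x i. x \<in> torus L}"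

definition infnorm_int :: "int ^ 'd \<Rightarrow> real" where
  "infnorm_int z = infnorm (\<chi> i. real_of_int (z $ i))"

text \<open>The uniform probability measure on the unit sphere, regarded as a Borel measure on the
  ambient space: the image of the uniform distribution on the unit ball under \<open>x \<mapsto> x / |x|\<close>.\<close>

definition sphere_uniform :: "(real ^ 'n) measure" where
  "sphere_uniform = distr (uniform_measure lborel (ball 0 1)) borel sgn"

text \<open>The sum over unordered edges is written as half the sum over ordered adjacent
  pairs; this is exact for \<open>L \<ge> 2\<close>, where no edge is a loop.\<close>

definition hamiltonian :: "nat \<Rightarrow> (int ^ 'd \<Rightarrow> real ^ 'n) \<Rightarrow> real" where
  "hamiltonian L \<phi> =
     - (\<Sum>(x, y) \<in> {(x, y) \<in> torus L \<times> torus L. {x, y} \<in> torus_edges L}. \<phi> x \<bullet> \<phi> y) / 2"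

definition spin_expectation ::
  "nat \<Rightarrow> real \<Rightarrow> ((int ^ 'd \<Rightarrow> real ^ 'n) \<Rightarrow> real) \<Rightarrow> real" where
  "spin_expectation L \<beta> f =
     (\<integral>\<phi>. f \<phi> * exp (- \<beta> * hamiltonian L \<phi>) \<partial>(Pi\<^sub>M (torus L) (\<lambda>_. sphere_uniform))) /
     (\<integral>(\<phi> :: int ^ 'd \<Rightarrow> real ^ 'n). exp (- \<beta> * hamiltonian L \<phi>)
        \<partial>(Pi\<^sub>M (torus L) (\<lambda>_. sphere_uniform)))"

lemma measurable_sgn_vec [measurable]: "(sgn :: real ^ 'n \<Rightarrow> real ^ 'n) \<in> borel_measurable borel"
  unfolding sgn_div_norm by measurable

lemma prob_space_uniform_ball: "prob_space (uniform_measure lborel (ball (0 :: real ^ 'n) 1))"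
proof (rule prob_space_uniform_measure)
  show "emeasure lborel (ball (0 :: real ^ 'n) 1) \<noteq> 0"
    using content_ball_pos[of 1 "0 :: real ^ 'n"] by (metis Sigma_Algebra.measure_def enn2real_0 less_irrefl zero_less_one)
  show "emeasure lborel (ball (0 :: real ^ 'n) 1) \<noteq> \<infinity>"
    using emeasure_lborel_ball_finite[of "0 :: real ^ 'n" 1] by auto
qed

lemma prob_space_sphere_uniform: "prob_space (sphere_uniform :: (real ^ 'n) measure)"
  unfolding sphere_uniform_def
  by (rule prob_space.prob_space_distr[OF prob_space_uniform_ball]) measurable

lemma AE_sphere_uniform: "AE u in (sphere_uniform :: (real ^ 'n) measure). u \<in> sphere 0 1"
proof -
  have "AE x in (lborel :: (real ^ 'n) measure). x \<noteq> 0"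
    by (rule AE_lborel_singleton)
  then have "AE x in uniform_measure lborel (ball (0 :: real ^ 'n) 1). sgn x \<in> sphere 0 1"
    by (intro AE_uniform_measureI) (auto simp: norm_sgn elim: eventually_mono)
  then show ?thesis
    unfolding sphere_uniform_def by (subst AE_distr_iff) auto
qed

end

theory Submission
  imports Defs
begin

text \<open>Write \<open>P\<close> for the set of ordered pairs of neighbours. On unit spins the Gibbs weight is, up to a
  constant factor, \<open>exp (- \<gamma> * (\<Sum>(u, v)\<in>P. (norm (\<phi> u - \<phi> v))\<^sup>2))\<close> with \<open>\<gamma> = \<beta> / 4\<close>. Reflections in
  planes bisecting edges show that inserting a field, \<open>\<phi> u - \<phi> v - h (u, v)\<close>, never increases the
  integral of this weight (Gaussian domination). Expanding to second order in \<open>h\<close> bounds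
  the second moment of \<open>\<Sum>(u, v)\<in>P. k (u, v) * (\<phi> u $ a - \<phi> v $ a)\<close> by \<open>(2 / \<beta>) * (\<Sum>p\<in>P. (k p)\<^sup>2)\<close>.

  If \<open>k\<close> is a unit flow from \<open>x\<close> to \<open>y\<close>, the sum is \<open>\<phi> x $ a - \<phi> y $ a\<close>. In dimension at least \<open>3\<close> there is
  such a flow of energy bounded uniformly in \<open>L\<close>: spread the mass at \<open>x\<close> over boxes of side
  \<open>1, 2, 4, \<dots>\<close>, move the large box, and contract it to \<open>y\<close>.
  Hence \<open>\<phi> x\<close> and \<open>\<phi> y\<close> are close in mean square for large \<open>\<beta>\<close>, for all \<open>x\<close> and \<open>y\<close> in the torus, and the
  correlation is close to the expectation of \<open>(\<phi> x $ a * \<phi> x $ b)\<^sup>2\<close>, which rotation invariance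
  bounds from below by \<open>1 / (3 * N\<^sup>2)\<close>.\<close>

section \<open>Reflection positivity\<close>

text \<open>Gaussian domination controls only differences along bonds, so a difference over a long
  distance must be written as a combination of them with a small sum of squared coefficients. A
  single path would cost energy proportional to its length. Moving a box of side \<open>n\<close> by
  at most \<open>n\<close> spreads the flow and costs energy at most
  \<open>n\<^sup>2 / n ^ d\<close>, which is at most \<open>1 / n\<close> once \<open>d\<close> is
  at least 3. The norms \<open>1 / sqrt n\<close> then sum geometrically over dyadic scales, whereas
  in dimension two every scale would cost the same.

  Reflection across a mirror that bisects bonds needs two congruent halves without a site on the
  mirror; this is what even \<open>L\<close> provides.

  The threshold: the flow has norm at most \<open>9 * d\<close>, so each of the two coordinates
  contributes a mean square difference of at most \<open>2 * 81 * d\<^sup>2 / \<beta>\<close>. Their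
  sum \<open>324 * d\<^sup>2 / \<beta>\<close> should use up at most half of the one-site bound
  \<open>1 / (3 * N\<^sup>2)\<close>. This requires \<open>\<beta>\<close> to be at least
  \<open>1944 * d\<^sup>2 * N\<^sup>2\<close> and leaves
  \<open>c1 = 1 / (6 * N\<^sup>2)\<close>.\<close>

lemma nn_integral_kernel_Fubini:
  fixes k1 :: "'a \<Rightarrow> 's \<Rightarrow> ennreal" and k2 :: "'b \<Rightarrow> 's \<Rightarrow> ennreal"
  assumes M: "sigma_finite_measure M" and N: "sigma_finite_measure N" and S: "sigma_finite_measure S"
    and [measurable]: "(\<lambda>(x, s). k1 x s) \<in> borel_measurable (M \<Otimes>\<^sub>M S)"
    and [measurable]: "(\<lambda>(y, s). k2 y s) \<in> borel_measurable (N \<Otimes>\<^sub>M S)"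
  shows "(\<integral>\<^sup>+x. \<integral>\<^sup>+y. \<integral>\<^sup>+s. k1 x s * k2 y s \<partial>S \<partial>N \<partial>M)
    = (\<integral>\<^sup>+s. (\<integral>\<^sup>+x. k1 x s \<partial>M) * (\<integral>\<^sup>+y. k2 y s \<partial>N) \<partial>S)"
proof -
  interpret M: sigma_finite_measure M by fact
  interpret N: sigma_finite_measure N by fact
  interpret S: sigma_finite_measure S by fact
  interpret NS: pair_sigma_finite N S ..
  interpret MS: pair_sigma_finite M S ..
  have "(\<integral>\<^sup>+x. \<integral>\<^sup>+y. \<integral>\<^sup>+s. k1 x s * k2 y s \<partial>S \<partial>N \<partial>M)
      = (\<integral>\<^sup>+x. \<integral>\<^sup>+s. \<integral>\<^sup>+y. k1 x s * k2 y s \<partial>N \<partial>S \<partial>M)"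
    by (intro nn_integral_cong NS.Fubini'[symmetric]) measurable
  also have "\<dots> = (\<integral>\<^sup>+s. \<integral>\<^sup>+x. \<integral>\<^sup>+y. k1 x s * k2 y s \<partial>N \<partial>M \<partial>S)"
    by (intro MS.Fubini'[symmetric]) measurable
  also have "\<dots> = (\<integral>\<^sup>+s. (\<integral>\<^sup>+x. k1 x s \<partial>M) * (\<integral>\<^sup>+y. k2 y s \<partial>N) \<partial>S)"
    by (intro nn_integral_cong) (simp add: nn_integral_cmult nn_integral_multc)
  finally show ?thesis .
qed

text \<open>By Tonelli each of the three triple integrals is an inner product over \<open>S\<close>
  of functions obtained by integrating out \<open>x\<close> or \<open>y\<close>; the claim is the
  Cauchy-Schwarz inequality for these two functions of \<open>s\<close>.\<close>

lemma nn_integral_kernel_Cauchy_Schwarz: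
  fixes k1 :: "'a \<Rightarrow> 's \<Rightarrow> ennreal" and k2 :: "'b \<Rightarrow> 's \<Rightarrow> ennreal"
  assumes M: "sigma_finite_measure M" and N: "sigma_finite_measure N" and S: "sigma_finite_measure S"
    and k1[measurable]: "(\<lambda>(x, s). k1 x s) \<in> borel_measurable (M \<Otimes>\<^sub>M S)"
    and k2[measurable]: "(\<lambda>(y, s). k2 y s) \<in> borel_measurable (N \<Otimes>\<^sub>M S)"
  shows "(\<integral>\<^sup>+x. \<integral>\<^sup>+y. \<integral>\<^sup>+s. k1 x s * k2 y s \<partial>S \<partial>N \<partial>M)\<^sup>2
    \<le> (\<integral>\<^sup>+x. \<integral>\<^sup>+x'. \<integral>\<^sup>+s. k1 x s * k1 x' s \<partial>S \<partial>M \<partial>M)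
      * (\<integral>\<^sup>+y. \<integral>\<^sup>+y'. \<integral>\<^sup>+s. k2 y s * k2 y' s \<partial>S \<partial>N \<partial>N)"
proof -
  interpret M: sigma_finite_measure M by fact
  interpret N: sigma_finite_measure N by fact
  have [measurable]: "(\<lambda>(s, x). k1 x s) \<in> borel_measurable (S \<Otimes>\<^sub>M M)"
    "(\<lambda>(s, y). k2 y s) \<in> borel_measurable (S \<Otimes>\<^sub>M N)"
    using measurable_compose[OF measurable_pair_swap' k1] measurable_compose[OF measurable_pair_swap' k2]
    by (simp_all add: case_prod_unfold)
  show ?thesis
    using Cauchy_Schwarz_nn_integral[of "\<lambda>s. \<integral>\<^sup>+x. k1 x s \<partial>M" S "\<lambda>s. \<integral>\<^sup>+y. k2 y s \<partial>N"]
    by (simp add: nn_integral_kernel_Fubini[OF M N S k1 k2] nn_integral_kernel_Fubini[OF M M S k1 k1]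
        nn_integral_kernel_Fubini[OF N N S k2 k2] power2_eq_square)
qed

section \<open>Gaussian integrals and the Gaussian kernel as a superposition of products\<close>

lemma nn_integral_gauss_real:
  assumes "(\<gamma>::real) > 0"
  shows "(\<integral>\<^sup>+x. ennreal (exp (- \<gamma> * x\<^sup>2)) \<partial>lborel) < \<infinity>"
proof -
  define \<sigma> where "\<sigma> = sqrt (1 / (2 * \<gamma>))"
  have \<sigma>: "\<sigma> > 0" "\<sigma>\<^sup>2 = 1 / (2 * \<gamma>)"
    using assms by (auto simp: \<sigma>_def)
  have "integrable lborel (\<lambda>x. sqrt (2 * pi * \<sigma>\<^sup>2) * normal_density 0 \<sigma> x)"
    using \<sigma> by (intro integrable_mult_right integrable_normal_density) auto
  also have "(\<lambda>x. sqrt (2 * pi * \<sigma>\<^sup>2) * normal_density 0 \<sigma> x) = (\<lambda>x. exp (- \<gamma> * x\<^sup>2))"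
    using \<sigma> assms by (auto simp: normal_density_def fun_eq_iff)
  finally have "(\<integral>\<^sup>+x. ennreal (norm (exp (- \<gamma> * x\<^sup>2))) \<partial>lborel) < \<infinity>"
    by (simp only: integrable_iff_bounded)
  then show ?thesis by simp
qed

lemma nn_integral_gauss:
  assumes "(\<gamma>::real) > 0"
  shows "(\<integral>\<^sup>+x. ennreal (exp (- \<gamma> * (norm (x :: 'b :: euclidean_space))\<^sup>2)) \<partial>lborel) < \<infinity>"
proof -
  have "(\<integral>\<^sup>+x. ennreal (exp (- \<gamma> * (norm (x :: 'b))\<^sup>2)) \<partial>lborel)
      = (\<integral>\<^sup>+x. (\<Prod>b\<in>Basis. ennreal (exp (- \<gamma> * (x \<bullet> b)\<^sup>2))) \<partial>(lborel :: 'b measure))"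
  proof (intro nn_integral_cong)
    fix x :: 'b
    have "(norm x)\<^sup>2 = (\<Sum>b\<in>Basis. (x \<bullet> b)\<^sup>2)"
      using euclidean_inner[of x x] by (subst power2_norm_eq_inner) (simp add: power2_eq_square)
    then show "ennreal (exp (- \<gamma> * (norm x)\<^sup>2)) = (\<Prod>b\<in>Basis. ennreal (exp (- \<gamma> * (x \<bullet> b)\<^sup>2)))"
      by (simp add: prod_ennreal sum_distrib_left flip: exp_sum sum_negf)
  qed
  also have "\<dots> = (\<Prod>b\<in>(Basis::'b set). \<integral>\<^sup>+x. ennreal (exp (- \<gamma> * x\<^sup>2)) \<partial>lborel)"
    by (rule nn_integral_lborel_prod) auto
  also have "\<dots> < \<infinity>"
    using nn_integral_gauss_real[OF assms] by (simp add: power_less_top_ennreal)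
  finally show ?thesis .
qed

text \<open>The Gaussian weight of a crossing edge is an inner product of two functions, one for each
  endpoint: this is what makes the model reflection positive.\<close>

lemma gauss_kernel_factor:
  assumes \<gamma>: "(\<gamma>::real) > 0"
  shows "\<exists>c. \<forall>u v :: 'b :: euclidean_space. ennreal (exp (- \<gamma> * (norm (u - v))\<^sup>2)) =
    c * (\<integral>\<^sup>+s. ennreal (exp (- 2 * \<gamma> * (norm (u - s))\<^sup>2)) * ennreal (exp (- 2 * \<gamma> * (norm (v - s))\<^sup>2)) \<partial>lborel)"
proof -
  define G where "G = (\<integral>\<^sup>+x. ennreal (exp (- (4 * \<gamma>) * (norm (x :: 'b))\<^sup>2)) \<partial>lborel)"
  have "G < \<infinity>"
    unfolding G_def using \<gamma> by (intro nn_integral_gauss) auto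
  moreover have "G \<noteq> 0"
  proof
    assume "G = 0"
    then have "AE x in (lborel :: 'b measure). False"
      unfolding G_def by (subst (asm) nn_integral_0_iff_AE) auto
    then show False by (auto simp: eventually_False ae_filter_eq_bot_iff)
  qed
  ultimately have G: "inverse G * G = 1"
    by (simp add: ennreal_divide_self[unfolded divide_ennreal_def] mult.commute)
  have "(\<integral>\<^sup>+s. ennreal (exp (- 2 * \<gamma> * (norm (u - s))\<^sup>2)) * ennreal (exp (- 2 * \<gamma> * (norm (v - s))\<^sup>2)) \<partial>lborel)
      = ennreal (exp (- \<gamma> * (norm (u - v))\<^sup>2)) * G" for u v :: 'b
  proof -
    \<comment> \<open>Parallelogram identity about the midpoint \<open>m\<close>: the product of the
      two Gaussians splits into the wanted kernel in \<open>u - v\<close> and a Gaussian in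
      \<open>s\<close> centred at \<open>m\<close>, whose integral \<open>G\<close> does not depend
      on \<open>u\<close> and \<open>v\<close> by translation invariance.\<close>
    define m where "m = (1/2) *\<^sub>R (u + v)"
    have *: "(norm (u - s))\<^sup>2 + (norm (v - s))\<^sup>2 = 2 * (norm (s - m))\<^sup>2 + (norm (u - v))\<^sup>2 / 2" for s
      unfolding m_def power2_norm_eq_inner
      by (simp add: inner_diff_left inner_diff_right inner_add_left inner_add_right inner_commute field_simps)
    have "exp (- 2 * \<gamma> * (norm (u - s))\<^sup>2) * exp (- 2 * \<gamma> * (norm (v - s))\<^sup>2)
        = exp (- 2 * \<gamma> * ((norm (u - s))\<^sup>2 + (norm (v - s))\<^sup>2))" for s
      by (simp add: algebra_simps flip: exp_add)
    then have "exp (- 2 * \<gamma> * (norm (u - s))\<^sup>2) * exp (- 2 * \<gamma> * (norm (v - s))\<^sup>2)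
        = exp (- \<gamma> * (norm (u - v))\<^sup>2) * exp (- (4 * \<gamma>) * (norm (s - m))\<^sup>2)" for s
      unfolding * by (simp add: algebra_simps flip: exp_add)
    then have "(\<integral>\<^sup>+s. ennreal (exp (- 2 * \<gamma> * (norm (u - s))\<^sup>2)) * ennreal (exp (- 2 * \<gamma> * (norm (v - s))\<^sup>2)) \<partial>lborel)
       = (\<integral>\<^sup>+s. ennreal (exp (- \<gamma> * (norm (u - v))\<^sup>2)) * ennreal (exp (- (4 * \<gamma>) * (norm (s - m))\<^sup>2)) \<partial>lborel)"
      by (intro nn_integral_cong) (simp flip: ennreal_mult')
    also have "\<dots> = ennreal (exp (- \<gamma> * (norm (u - v))\<^sup>2)) *
        (\<integral>\<^sup>+s. ennreal (exp (- (4 * \<gamma>) * (norm (s - m))\<^sup>2)) \<partial>lborel)"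
      by (rule nn_integral_cmult) auto
    also have "(\<integral>\<^sup>+s. ennreal (exp (- (4 * \<gamma>) * (norm (s - m))\<^sup>2)) \<partial>lborel)
        = (\<integral>\<^sup>+s. ennreal (exp (- (4 * \<gamma>) * (norm (s - m))\<^sup>2)) \<partial>(distr lborel borel (\<lambda>x. m + x)))"
      by (subst lborel_distr_plus) simp
    also have "\<dots> = G"
      unfolding G_def by (subst nn_integral_distr) auto
    finally show ?thesis .
  qed
  then have "ennreal (exp (- \<gamma> * (norm (u - v))\<^sup>2)) = inverse G * (\<integral>\<^sup>+s. ennreal (exp (- 2 * \<gamma> * (norm (u - s))\<^sup>2)) * ennreal (exp (- 2 * \<gamma> * (norm (v - s))\<^sup>2)) \<partial>lborel)" for u v :: 'b
    using G by (simp add: mult.left_commute[of "inverse G"])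
  then show ?thesis by blast
qed

text \<open>Two configurations and two endpoint maps serve two situations:
  \<open>\<phi> = \<psi>\<close> with \<open>fst\<close> and \<open>snd\<close> for bonds inside one
  graph, and a configuration per half, with both endpoint maps equal, for bonds cut by a mirror once
  one half has been folded onto the other.\<close>

definition bond_energy :: "'e set \<Rightarrow> ('e \<Rightarrow> 'v) \<Rightarrow> ('e \<Rightarrow> 'v) \<Rightarrow> ('e \<Rightarrow> 'b) \<Rightarrow> ('v \<Rightarrow> 'b) \<Rightarrow> ('v \<Rightarrow> 'b :: real_normed_vector) \<Rightarrow> real" where
  "bond_energy E a b h \<phi> \<psi> = (\<Sum>p\<in>E. (norm (\<phi> (a p) - \<psi> (b p) - h p))\<^sup>2)"

lemma bond_energy_nonneg: "bond_energy E a b h \<phi> \<psi> \<ge> 0"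
  unfolding bond_energy_def by (intro sum_nonneg) auto

text \<open>The constraint on the spins is carried by the law \<open>\<rho>\<close> of a single spin
  on the ambient space. The field shifts \<open>\<phi> u - \<phi> v\<close> off the sphere
  differences, so the weight has to make sense on the whole Euclidean space.\<close>

locale single_spin =
  fixes \<gamma> :: real and \<rho> :: "'b :: euclidean_space measure"
  assumes \<gamma>: "\<gamma> > 0" and prob_\<rho>: "prob_space \<rho>" and sets_\<rho>: "sets \<rho> = sets borel"
begin

text \<open>A system with a mirror, after folding: both halves live on the same vertex set
  \<open>A\<close>, \<open>I\<close> holds the bonds inside a half, and a cut bond \<open>p\<close>
  couples \<open>\<phi>\<close> and \<open>\<psi>\<close> at the single vertex \<open>ap p\<close>.
  The field on a cut bond is split as \<open>c1 p - c2 p\<close> so that each half owns a part of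
  it.\<close>

definition two_sided :: "'v set \<Rightarrow> ('v \<times> 'v) set \<Rightarrow> 'c set \<Rightarrow> ('c \<Rightarrow> 'v) \<Rightarrow>
    ('v \<times> 'v \<Rightarrow> 'b) \<Rightarrow> ('c \<Rightarrow> 'b) \<Rightarrow> ('v \<times> 'v \<Rightarrow> 'b) \<Rightarrow> ('c \<Rightarrow> 'b) \<Rightarrow> ennreal" where
  "two_sided A I C ap f1 c1 f2 c2 =
    (\<integral>\<^sup>+\<phi>. \<integral>\<^sup>+\<psi>. ennreal (exp (- \<gamma> * (bond_energy I fst snd f1 \<phi> \<phi> + bond_energy I fst snd f2 \<psi> \<psi>
      + bond_energy C ap ap (\<lambda>p. c1 p - c2 p) \<phi> \<psi>)))
      \<partial>(Pi\<^sub>M A (\<lambda>_. \<rho>)) \<partial>(Pi\<^sub>M A (\<lambda>_. \<rho>)))"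

lemma measurable_spin: "x \<in> A \<Longrightarrow> (\<lambda>\<phi>. \<phi> x) \<in> borel_measurable (Pi\<^sub>M A (\<lambda>_. \<rho>))"
  using measurable_component_singleton[of x A "\<lambda>_. \<rho>"] measurable_cong_sets[OF refl sets_\<rho>] by blast

text \<open>Opening each cut bond with an auxiliary variable \<open>s p\<close> through
  \<open>gauss_kernel_factor\<close> makes the weight, for fixed \<open>s\<close>, a product of a
  function of \<open>\<phi>\<close> and a function of \<open>\<psi>\<close>. The kernel inequality
  then applies with \<open>s\<close> as the shared variable.\<close>

lemma two_sided_Cauchy_Schwarz:
  assumes A: "finite A" and I: "I \<subseteq> A \<times> A" and C: "finite C" "ap ` C \<subseteq> A"
  shows "(two_sided A I C ap f1 c1 f2 c2)\<^sup>2 \<le> two_sided A I C ap f1 c1 f1 c1 * two_sided A I C ap f2 c2 f2 c2"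
proof -
  define M where "M = Pi\<^sub>M A (\<lambda>_. \<rho>)"
  define S where "S = Pi\<^sub>M C (\<lambda>_. lborel :: 'b measure)"
  interpret \<rho>: prob_space \<rho> by (rule prob_\<rho>)
  interpret PA: product_sigma_finite "\<lambda>_. \<rho>" ..
  interpret PC: product_sigma_finite "\<lambda>_. lborel :: 'b measure" ..
  have M: "sigma_finite_measure M" and S: "sigma_finite_measure S"
    unfolding M_def S_def using PA.sigma_finite PC.sigma_finite A C by auto
  have [simp]: "finite I" using A I finite_subset by blast
  obtain c where c: "\<And>u v :: 'b. ennreal (exp (- \<gamma> * (norm (u - v))\<^sup>2)) =
    c * (\<integral>\<^sup>+s. ennreal (exp (- 2 * \<gamma> * (norm (u - s))\<^sup>2)) * ennreal (exp (- 2 * \<gamma> * (norm (v - s))\<^sup>2)) \<partial>lborel)"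
    using gauss_kernel_factor[OF \<gamma>] by blast
  \<comment> \<open>The share of one half: its interior weight times its factor of every opened cut
    bond, where the half's own part \<open>g\<close> of the crossing field shifts the spin.\<close>
  define k where "k f g \<phi> s = ennreal (exp (- \<gamma> * bond_energy I fst snd f \<phi> \<phi>)) *
      (\<Prod>p\<in>C. ennreal (exp (- 2 * \<gamma> * (norm (\<phi> (ap p) - g p - s p))\<^sup>2)))" for f :: "_ \<Rightarrow> 'b" and g :: "_ \<Rightarrow> 'b" and \<phi> s :: "_ \<Rightarrow> 'b"
  have meas: "(\<lambda>(\<phi>, s). k f g \<phi> s) \<in> borel_measurable (M \<Otimes>\<^sub>M S)" for f g
  proof -
    have [measurable]: "(\<lambda>z. fst z x) \<in> borel_measurable (M \<Otimes>\<^sub>M S)" if "x \<in> A" for x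
      using measurable_compose[OF measurable_fst, OF measurable_spin[OF that]] by (simp add: M_def)
    have [measurable]: "(\<lambda>z. snd z p) \<in> borel_measurable (M \<Otimes>\<^sub>M S)" if "p \<in> C" for p
    proof -
      have "(\<lambda>s. s p) \<in> borel_measurable S"
        unfolding S_def using measurable_component_singleton[OF that, of "\<lambda>_. lborel :: 'b measure"] by simp
      from measurable_compose[OF measurable_snd this] show ?thesis .
    qed
    have 1: "(\<lambda>z. bond_energy I fst snd f (fst z) (fst z)) \<in> borel_measurable (M \<Otimes>\<^sub>M S)"
      unfolding bond_energy_def using I by (intro borel_measurable_sum) (auto intro!: borel_measurable_diff borel_measurable_power borel_measurable_norm)
    have 2: "(\<lambda>z. \<Prod>p\<in>C. ennreal (exp (- 2 * \<gamma> * (norm (fst z (ap p) - g p - snd z p))\<^sup>2))) \<in> borel_measurable (M \<Otimes>\<^sub>M S)"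
    proof (intro borel_measurable_prod_ennreal)
      fix p assume "p \<in> C"
      then have "ap p \<in> A" "p \<in> C" using C by auto
      then show "(\<lambda>z. ennreal (exp (- 2 * \<gamma> * (norm (fst z (ap p) - g p - snd z p))\<^sup>2))) \<in> borel_measurable (M \<Otimes>\<^sub>M S)"
        by measurable
    qed
    show ?thesis
      unfolding k_def case_prod_unfold using 1 2 by measurable
  qed
  have eq: "two_sided A I C ap f1 c1 f2 c2
      = c ^ card C * (\<integral>\<^sup>+\<phi>. \<integral>\<^sup>+\<psi>. \<integral>\<^sup>+s. k f1 c1 \<phi> s * k f2 c2 \<psi> s \<partial>S \<partial>M \<partial>M)" for f1 c1 f2 c2
  proof -
    have *: "ennreal (exp (- \<gamma> * (bond_energy I fst snd f1 \<phi> \<phi> + bond_energy I fst snd f2 \<psi> \<psi>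
      + bond_energy C ap ap (\<lambda>p. c1 p - c2 p) \<phi> \<psi>))) = c ^ card C * (\<integral>\<^sup>+s. k f1 c1 \<phi> s * k f2 c2 \<psi> s \<partial>S)" for \<phi> \<psi>
    proof -
      define e where "e = ennreal (exp (- \<gamma> * bond_energy I fst snd f1 \<phi> \<phi>)) * ennreal (exp (- \<gamma> * bond_energy I fst snd f2 \<psi> \<psi>))"
      define q where "q p t = ennreal (exp (- 2 * \<gamma> * (norm (\<phi> (ap p) - c1 p - t))\<^sup>2)) * ennreal (exp (- 2 * \<gamma> * (norm (\<psi> (ap p) - c2 p - t))\<^sup>2))" for p t
      have "ennreal (exp (- \<gamma> * (bond_energy I fst snd f1 \<phi> \<phi> + bond_energy I fst snd f2 \<psi> \<psi>
          + bond_energy C ap ap (\<lambda>p. c1 p - c2 p) \<phi> \<psi>)))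
         = e * ennreal (exp (- \<gamma> * bond_energy C ap ap (\<lambda>p. c1 p - c2 p) \<phi> \<psi>))"
        unfolding e_def by (simp add: algebra_simps exp_add exp_diff exp_minus divide_simps flip: ennreal_mult')
      also have "ennreal (exp (- \<gamma> * bond_energy C ap ap (\<lambda>p. c1 p - c2 p) \<phi> \<psi>))
         = (\<Prod>p\<in>C. ennreal (exp (- \<gamma> * (norm ((\<phi> (ap p) - c1 p) - (\<psi> (ap p) - c2 p)))\<^sup>2)))"
        unfolding bond_energy_def
        by (simp add: prod_ennreal sum_distrib_left algebra_simps C(1) flip: exp_sum sum_negf)
      also have "\<dots> = (\<Prod>p\<in>C. c * (\<integral>\<^sup>+t. q p t \<partial>lborel))"
        unfolding c q_def ..
      also have "\<dots> = c ^ card C * (\<Prod>p\<in>C. \<integral>\<^sup>+t. q p t \<partial>lborel)"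
        by (simp add: prod.distrib)
      also have "(\<Prod>p\<in>C. \<integral>\<^sup>+t. q p t \<partial>lborel) = (\<integral>\<^sup>+s. (\<Prod>p\<in>C. q p (s p)) \<partial>S)"
        unfolding S_def by (intro PC.product_nn_integral_prod[symmetric]) (auto simp: C q_def)
      also have "e * (c ^ card C * (\<integral>\<^sup>+s. (\<Prod>p\<in>C. q p (s p)) \<partial>S)) = c ^ card C * (\<integral>\<^sup>+s. e * (\<Prod>p\<in>C. q p (s p)) \<partial>S)"
      proof -
        have "(\<lambda>s. (\<Prod>p\<in>C. q p (s p))) \<in> borel_measurable S"
          unfolding S_def q_def by measurable
        then show ?thesis by (simp add: nn_integral_cmult mult_ac)
      qed
      also have "(\<integral>\<^sup>+s. e * (\<Prod>p\<in>C. q p (s p)) \<partial>S) = (\<integral>\<^sup>+s. k f1 c1 \<phi> s * k f2 c2 \<psi> s \<partial>S)"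
        unfolding k_def e_def q_def by (simp add: prod.distrib mult_ac)
      finally show ?thesis .
    qed
    interpret M: sigma_finite_measure M by fact
    interpret S: sigma_finite_measure S by fact
    have [measurable]: "(\<lambda>(x, s). k f1 c1 x s) \<in> borel_measurable (M \<Otimes>\<^sub>M S)" "(\<lambda>(x, s). k f2 c2 x s) \<in> borel_measurable (M \<Otimes>\<^sub>M S)"
      by (rule meas)+
    show ?thesis
      unfolding two_sided_def * M_def[symmetric]
      by (subst nn_integral_cmult[symmetric], measurable)
       (intro nn_integral_cong nn_integral_cmult, measurable)
  qed
  have "(c ^ card C)\<^sup>2 * (\<integral>\<^sup>+\<phi>. \<integral>\<^sup>+\<psi>. \<integral>\<^sup>+s. k f1 c1 \<phi> s * k f2 c2 \<psi> s \<partial>S \<partial>M \<partial>M)\<^sup>2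
     \<le> (c ^ card C)\<^sup>2 * ((\<integral>\<^sup>+\<phi>. \<integral>\<^sup>+\<psi>. \<integral>\<^sup>+s. k f1 c1 \<phi> s * k f1 c1 \<psi> s \<partial>S \<partial>M \<partial>M) * (\<integral>\<^sup>+\<phi>. \<integral>\<^sup>+\<psi>. \<integral>\<^sup>+s. k f2 c2 \<phi> s * k f2 c2 \<psi> s \<partial>S \<partial>M \<partial>M))"
    by (intro mult_left_mono nn_integral_kernel_Cauchy_Schwarz M S meas) auto
  then show ?thesis
    unfolding eq by (simp add: power2_eq_square mult_ac)
qed

end

text \<open>\<open>A\<close> is one side of the mirror. The third clause of the second line excludes
  fixed vertices, and the last condition says that the mirror bisects every bond it meets, since the
  ends of such a bond are images of each other.\<close>

definition reflects :: "'v set \<Rightarrow> ('v \<times> 'v) set \<Rightarrow> ('v \<Rightarrow> 'v) \<Rightarrow> 'v set \<Rightarrow> bool" where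
  "reflects V P \<theta> A \<longleftrightarrow> A \<subseteq> V
    \<and> (\<forall>x\<in>V. \<theta> x \<in> V \<and> \<theta> (\<theta> x) = x \<and> (\<theta> x \<in> A \<longleftrightarrow> x \<notin> A))
    \<and> (\<forall>p\<in>P. map_prod \<theta> \<theta> p \<in> P)
    \<and> (\<forall>p\<in>P. (fst p \<in> A) \<noteq> (snd p \<in> A) \<longrightarrow> snd p = \<theta> (fst p))"

text \<open>The value 0 on cut bonds is what Cauchy-Schwarz dictates: pairing a half with a copy of
  itself gives the crossing field \<open>c1 p - c1 p\<close>.\<close>

definition reflect_field :: "('v \<Rightarrow> 'v) \<Rightarrow> 'v set \<Rightarrow> ('v \<times> 'v \<Rightarrow> 'b) \<Rightarrow> 'v \<times> 'v \<Rightarrow> 'b::zero" where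
  "reflect_field \<theta> A h p =
    (if fst p \<in> A \<and> snd p \<in> A then h p
     else if fst p \<notin> A \<and> snd p \<notin> A then h (map_prod \<theta> \<theta> p) else 0)"

context single_spin
begin

definition partition :: "'v set \<Rightarrow> ('v \<times> 'v) set \<Rightarrow> ('v \<times> 'v \<Rightarrow> 'b) \<Rightarrow> ennreal" where
  "partition V P h = (\<integral>\<^sup>+\<phi>. ennreal (exp (- \<gamma> * bond_energy P fst snd h \<phi> \<phi>)) \<partial>(Pi\<^sub>M V (\<lambda>_. \<rho>)))"

lemma measurable_bond_energy:
  assumes "P \<subseteq> V \<times> V"
  shows "(\<lambda>\<phi>. bond_energy P fst snd h \<phi> \<phi>) \<in> borel_measurable (Pi\<^sub>M V (\<lambda>_. \<rho>))"
  unfolding bond_energy_def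
proof (intro borel_measurable_sum)
  fix p assume "p \<in> P"
  then have "fst p \<in> V" "snd p \<in> V" using assms by auto
  note [measurable] = this[THEN measurable_spin]
  show "(\<lambda>\<phi>. (norm (\<phi> (fst p) - \<phi> (snd p) - h p))\<^sup>2) \<in> borel_measurable (Pi\<^sub>M V (\<lambda>_. \<rho>))"
    by measurable
qed

text \<open>\<open>\<theta>\<close> maps \<open>A\<close> bijectively onto \<open>V - A\<close> and
  all spins have the same law, so two independent configurations on \<open>A\<close> assemble into
  one on \<open>V\<close>. It suffices to check this on boxes, whose preimages are products of
  boxes.\<close>

lemma distr_glue_halves:
  assumes V: "finite V" and A: "A \<subseteq> V"
    and \<theta>: "\<And>x. x \<in> V \<Longrightarrow> \<theta> x \<in> V \<and> \<theta> (\<theta> x) = x \<and> (\<theta> x \<in> A \<longleftrightarrow> x \<notin> A)"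
  shows "distr (Pi\<^sub>M A (\<lambda>_. \<rho>) \<Otimes>\<^sub>M Pi\<^sub>M A (\<lambda>_. \<rho>)) (Pi\<^sub>M V (\<lambda>_. \<rho>))
      (\<lambda>(\<phi>, \<psi>). \<lambda>x\<in>V. if x \<in> A then \<phi> x else \<psi> (\<theta> x)) = Pi\<^sub>M V (\<lambda>_. \<rho>)"
    and "(\<lambda>(\<phi>, \<psi>). \<lambda>x\<in>V. if x \<in> A then \<phi> x else \<psi> (\<theta> x))
      \<in> (Pi\<^sub>M A (\<lambda>_. \<rho>) \<Otimes>\<^sub>M Pi\<^sub>M A (\<lambda>_. \<rho>)) \<rightarrow>\<^sub>M Pi\<^sub>M V (\<lambda>_. \<rho>)"
proof -
  let ?M = "Pi\<^sub>M A (\<lambda>_. \<rho>)" and ?g = "\<lambda>(\<phi>, \<psi>). \<lambda>x\<in>V. if x \<in> A then \<phi> x else \<psi> (\<theta> x)"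
  interpret \<rho>: prob_space \<rho> by (rule prob_\<rho>)
  interpret P: product_sigma_finite "\<lambda>_. \<rho>" ..
  have fin: "finite A" using A V finite_subset by blast
  interpret M: sigma_finite_measure ?M by (rule P.sigma_finite[OF fin])
  show g: "?g \<in> ?M \<Otimes>\<^sub>M ?M \<rightarrow>\<^sub>M Pi\<^sub>M V (\<lambda>_. \<rho>)"
    unfolding case_prod_unfold
  proof (intro measurable_restrict)
    fix x assume "x \<in> V"
    show "(\<lambda>z. if x \<in> A then fst z x else snd z (\<theta> x)) \<in> ?M \<Otimes>\<^sub>M ?M \<rightarrow>\<^sub>M \<rho>"
    proof (cases "x \<in> A")
      case True
      then show ?thesis
        using measurable_compose[OF measurable_fst measurable_component_singleton[OF True]] by simp
    next
      case False
      then have "\<theta> x \<in> A" using \<theta> \<open>x \<in> V\<close> by auto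
      with False show ?thesis
        using measurable_compose[OF measurable_snd measurable_component_singleton[of "\<theta> x"]] by simp
    qed
  qed
  show "distr (?M \<Otimes>\<^sub>M ?M) (Pi\<^sub>M V (\<lambda>_. \<rho>)) ?g = Pi\<^sub>M V (\<lambda>_. \<rho>)"
  proof (rule P.PiM_eqI)
    show "finite V" by fact
    fix S assume S: "\<And>x. x \<in> V \<Longrightarrow> S x \<in> sets \<rho>"
    have pre: "?g -` Pi\<^sub>E V S \<inter> space (?M \<Otimes>\<^sub>M ?M) = Pi\<^sub>E A S \<times> Pi\<^sub>E A (\<lambda>y. S (\<theta> y))"
    proof (intro set_eqI iffI)
      fix z assume z: "z \<in> ?g -` Pi\<^sub>E V S \<inter> space (?M \<Otimes>\<^sub>M ?M)"
      then have "z \<in> space (?M \<Otimes>\<^sub>M ?M)" and gz: "?g z \<in> Pi\<^sub>E V S"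
        by blast+
      then have sp: "fst z \<in> extensional A" "snd z \<in> extensional A"
        by (simp_all add: space_pair_measure space_PiM PiE_iff mem_Times_iff)
      have *: "(if x \<in> A then fst z x else snd z (\<theta> x)) \<in> S x" if "x \<in> V" for x
        using PiE_mem[OF gz that] that by (simp add: case_prod_unfold)
      have "fst z x \<in> S x" if "x \<in> A" for x
        using *[of x] that A by auto
      moreover have "snd z x \<in> S (\<theta> x)" if "x \<in> A" for x
      proof -
        have "x \<in> V" using that A by auto
        then show ?thesis using *[of "\<theta> x"] \<theta>[of x] that by simp
      qed
      ultimately show "z \<in> Pi\<^sub>E A S \<times> Pi\<^sub>E A (\<lambda>y. S (\<theta> y))"
        using sp by (simp add: mem_Times_iff PiE_iff)
    next
      fix z assume z: "z \<in> Pi\<^sub>E A S \<times> Pi\<^sub>E A (\<lambda>y. S (\<theta> y))"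
      have "snd z (\<theta> x) \<in> S x" if "x \<in> V" "x \<notin> A" for x
      proof -
        have "\<theta> x \<in> A" "\<theta> (\<theta> x) = x" using \<theta>[OF that(1)] that by auto
        moreover have "\<And>y. y \<in> A \<Longrightarrow> snd z y \<in> S (\<theta> y)" using z by (auto simp: mem_Times_iff PiE_iff)
        ultimately show ?thesis by metis
      qed
      then have "?g z \<in> Pi\<^sub>E V S"
        using z A by (auto simp: mem_Times_iff PiE_iff case_prod_unfold)
      moreover have "z \<in> space (?M \<Otimes>\<^sub>M ?M)"
      proof -
        have "S x \<subseteq> space \<rho>" "S (\<theta> x) \<subseteq> space \<rho>" if "x \<in> A" for x
          using that A \<theta> S[THEN sets.sets_into_space] by auto
        then show ?thesis
          using z by (simp add: mem_Times_iff PiE_iff space_pair_measure space_PiM subset_iff)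
      qed
      ultimately show "z \<in> ?g -` Pi\<^sub>E V S \<inter> space (?M \<Otimes>\<^sub>M ?M)"
        by auto
    qed
    have S1: "\<And>x. x \<in> A \<Longrightarrow> S x \<in> sets \<rho>" and S2: "\<And>x. x \<in> A \<Longrightarrow> S (\<theta> x) \<in> sets \<rho>"
      using S A \<theta> by auto
    have "emeasure (distr (?M \<Otimes>\<^sub>M ?M) (Pi\<^sub>M V (\<lambda>_. \<rho>)) ?g) (Pi\<^sub>E V S)
        = emeasure (?M \<Otimes>\<^sub>M ?M) (Pi\<^sub>E A S \<times> Pi\<^sub>E A (\<lambda>y. S (\<theta> y)))"
      using g S V by (subst emeasure_distr) (auto simp: pre intro!: sets_PiM_I_finite)
    also have "\<dots> = (\<Prod>x\<in>A. emeasure \<rho> (S x)) * (\<Prod>x\<in>A. emeasure \<rho> (S (\<theta> x)))"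
      using S1 S2 fin
      by (subst M.emeasure_pair_measure_Times)
        (auto intro!: sets_PiM_I_finite arg_cong2[of _ _ _ _ "(*)"] P.emeasure_PiM)
    also have "(\<Prod>x\<in>A. emeasure \<rho> (S (\<theta> x))) = (\<Prod>x\<in>V-A. emeasure \<rho> (S x))"
      using \<theta> A by (intro prod.reindex_bij_witness[of _ \<theta> \<theta>]) auto
    also have "(\<Prod>x\<in>A. emeasure \<rho> (S x)) * (\<Prod>x\<in>V-A. emeasure \<rho> (S x)) = (\<Prod>x\<in>V. emeasure \<rho> (S x))"
      using prod.subset_diff[OF A V, of "\<lambda>x. emeasure \<rho> (S x)"] by (simp add: mult.commute)
    finally show "emeasure (distr (?M \<Otimes>\<^sub>M ?M) (Pi\<^sub>M V (\<lambda>_. \<rho>)) ?g) (Pi\<^sub>E V S) = (\<Prod>x\<in>V. emeasure \<rho> (S x))" .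
  qed simp
qed

lemma two_sided_cong:
  assumes "\<And>p. p \<in> I \<Longrightarrow> f1 p = f1' p" "\<And>p. p \<in> I \<Longrightarrow> f2 p = f2' p" "\<And>p. p \<in> C \<Longrightarrow> c1 p - c2 p = c1' p - c2' p"
  shows "two_sided A I C ap f1 c1 f2 c2 = two_sided A I C ap f1' c1' f2' c2'"
proof -
  have "bond_energy I fst snd f1 \<phi> \<phi> = bond_energy I fst snd f1' \<phi> \<phi>"
    "bond_energy I fst snd f2 \<phi> \<phi> = bond_energy I fst snd f2' \<phi> \<phi>"
    "bond_energy C ap ap (\<lambda>p. c1 p - c2 p) \<phi> \<psi> = bond_energy C ap ap (\<lambda>p. c1' p - c2' p) \<phi> \<psi>"
    for \<phi> \<psi>
    unfolding bond_energy_def using assms by (auto intro!: sum.cong)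
  then show ?thesis
    unfolding two_sided_def by presburger
qed

text \<open>Folding along \<open>\<theta>\<close> turns a cut bond \<open>(u, \<theta> u)\<close>
  into a coupling of \<open>\<phi>\<close> and \<open>\<psi>\<close> at one vertex. The whole
  crossing field is attributed to the \<open>\<phi>\<close> side, with a minus sign for pairs
  oriented from outside \<open>A\<close> into \<open>A\<close>; on the \<open>\<psi>\<close> side it
  is 0.\<close>

lemma partition_eq_two_sided:
  fixes h :: "'v \<times> 'v \<Rightarrow> 'b"
  assumes V: "finite V" and P: "P \<subseteq> V \<times> V" and r: "reflects V P \<theta> A"
  shows "partition V P h = two_sided A {p\<in>P. fst p \<in> A \<and> snd p \<in> A} {p\<in>P. (fst p \<in> A) \<noteq> (snd p \<in> A)}
     (\<lambda>p. if fst p \<in> A then fst p else snd p) h (\<lambda>p. if fst p \<in> A then h p else - h p)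
     (\<lambda>p. h (map_prod \<theta> \<theta> p)) (\<lambda>_. 0)"
proof -
  define I where "I = {p\<in>P. fst p \<in> A \<and> snd p \<in> A}"
  define J where "J = {p\<in>P. fst p \<notin> A \<and> snd p \<notin> A}"
  define C where "C = {p\<in>P. (fst p \<in> A) \<noteq> (snd p \<in> A)}"
  define ap where "ap p = (if fst p \<in> A then fst p else snd p)" for p :: "'v \<times> 'v"
  have A: "A \<subseteq> V" and \<theta>: "\<And>x. x \<in> V \<Longrightarrow> \<theta> x \<in> V \<and> \<theta> (\<theta> x) = x \<and> (\<theta> x \<in> A \<longleftrightarrow> x \<notin> A)"
    and \<theta>P: "\<And>p. p \<in> P \<Longrightarrow> map_prod \<theta> \<theta> p \<in> P"
    and \<theta>C: "\<And>p. p \<in> C \<Longrightarrow> snd p = \<theta> (fst p)"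
    using r by (auto simp: reflects_def C_def)
  have finP: "finite P" using P V finite_subset by blast
  have PV: "fst p \<in> V" "snd p \<in> V" if "p \<in> P" for p using that P by auto
  let ?M = "Pi\<^sub>M A (\<lambda>_. \<rho>)" and ?g = "\<lambda>(\<phi>, \<psi>). \<lambda>x\<in>V. if x \<in> A then \<phi> x else \<psi> (\<theta> x)"
  interpret \<rho>: prob_space \<rho> by (rule prob_\<rho>)
  interpret PP: product_sigma_finite "\<lambda>_. \<rho>" ..
  have fin: "finite A" using A V finite_subset by blast
  interpret M: sigma_finite_measure ?M by (rule PP.sigma_finite[OF fin])
  have g: "distr (?M \<Otimes>\<^sub>M ?M) (Pi\<^sub>M V (\<lambda>_. \<rho>)) ?g = Pi\<^sub>M V (\<lambda>_. \<rho>)"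
    "?g \<in> ?M \<Otimes>\<^sub>M ?M \<rightarrow>\<^sub>M Pi\<^sub>M V (\<lambda>_. \<rho>)"
    by (rule distr_glue_halves[OF V A], erule \<theta>)+
  have energy: "bond_energy P fst snd h (?g (\<phi>, \<psi>)) (?g (\<phi>, \<psi>)) =
     bond_energy I fst snd h \<phi> \<phi> + bond_energy I fst snd (\<lambda>p. h (map_prod \<theta> \<theta> p)) \<psi> \<psi>
      + bond_energy C ap ap (\<lambda>p. (if fst p \<in> A then h p else - h p) - 0) \<phi> \<psi>" for \<phi> \<psi>
  proof -
    define e where "e p = (norm (?g (\<phi>, \<psi>) (fst p) - ?g (\<phi>, \<psi>) (snd p) - h p))\<^sup>2" for p
    have "P = I \<union> J \<union> C" "I \<inter> J = {}" "(I \<union> J) \<inter> C = {}"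
      by (auto simp: I_def J_def C_def)
    then have "sum e P = sum e I + sum e J + sum e C"
      using finP by (metis finite_Un sum.union_disjoint)
    moreover have "sum e I = bond_energy I fst snd h \<phi> \<phi>"
      unfolding bond_energy_def by (intro sum.cong) (auto simp: e_def I_def dest: PV)
    moreover have "sum e J = bond_energy I fst snd (\<lambda>p. h (map_prod \<theta> \<theta> p)) \<psi> \<psi>"
      unfolding bond_energy_def
    proof (rule sum.reindex_bij_witness[of _ "map_prod \<theta> \<theta>" "map_prod \<theta> \<theta>"])
      fix p assume "p \<in> J"
      then have p: "p \<in> P" "fst p \<notin> A" "snd p \<notin> A" by (auto simp: J_def)
      show "map_prod \<theta> \<theta> (map_prod \<theta> \<theta> p) = p"
        using \<theta>[OF PV(1)[OF p(1)]] \<theta>[OF PV(2)[OF p(1)]] by (simp add: prod_eq_iff)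
      then show "(norm (\<psi> (fst (map_prod \<theta> \<theta> p)) - \<psi> (snd (map_prod \<theta> \<theta> p))
          - h (map_prod \<theta> \<theta> (map_prod \<theta> \<theta> p))))\<^sup>2 = e p"
        using p PV[OF p(1)] by (simp add: e_def)
      show "map_prod \<theta> \<theta> p \<in> I"
        using p \<theta>P[OF p(1)] \<theta>[OF PV(1)[OF p(1)]] \<theta>[OF PV(2)[OF p(1)]] by (simp add: I_def)
    next
      fix p assume "p \<in> I"
      then have p: "p \<in> P" "fst p \<in> A" "snd p \<in> A" by (auto simp: I_def)
      show "map_prod \<theta> \<theta> (map_prod \<theta> \<theta> p) = p"
        using \<theta>[OF PV(1)[OF p(1)]] \<theta>[OF PV(2)[OF p(1)]] by (simp add: prod_eq_iff)
      show "map_prod \<theta> \<theta> p \<in> J"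
        using p \<theta>P[OF p(1)] \<theta>[OF PV(1)[OF p(1)]] \<theta>[OF PV(2)[OF p(1)]] by (simp add: J_def)
    qed
    moreover have "sum e C = bond_energy C ap ap (\<lambda>p. (if fst p \<in> A then h p else - h p) - 0) \<phi> \<psi>"
      unfolding bond_energy_def
    proof (intro sum.cong refl)
      fix p assume p: "p \<in> C"
      then have fV: "fst p \<in> V" using PV by (simp add: C_def)
      note pV = \<theta>[OF this] \<theta>C[OF p]
      show "e p = (norm (\<phi> (ap p) - \<psi> (ap p) - ((if fst p \<in> A then h p else - h p) - 0)))\<^sup>2"
      proof (cases "fst p \<in> A")
        case True
        then show ?thesis using pV fV by (simp add: e_def ap_def)
      next
        case False
        have "norm (\<psi> (\<theta> (fst p)) - \<phi> (\<theta> (fst p)) - h p) = norm (\<phi> (\<theta> (fst p)) - \<psi> (\<theta> (fst p)) + h p)"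
          using norm_minus_cancel[of "\<psi> (\<theta> (fst p)) - \<phi> (\<theta> (fst p)) - h p"] by (simp add: algebra_simps)
        then show ?thesis using False pV fV by (simp add: e_def ap_def)
      qed
    qed
    ultimately show ?thesis by (simp add: bond_energy_def[of P] e_def)
  qed
  have m: "(\<lambda>\<phi>. ennreal (exp (- \<gamma> * bond_energy P fst snd h \<phi> \<phi>))) \<in> borel_measurable (Pi\<^sub>M V (\<lambda>_. \<rho>))"
    using measurable_bond_energy[OF P] by measurable
  have "partition V P h = (\<integral>\<^sup>+\<phi>. ennreal (exp (- \<gamma> * bond_energy P fst snd h \<phi> \<phi>)) \<partial>(distr (?M \<Otimes>\<^sub>M ?M) (Pi\<^sub>M V (\<lambda>_. \<rho>)) ?g))"
    by (simp only: partition_def g(1))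
  also have "\<dots> = (\<integral>\<^sup>+z. ennreal (exp (- \<gamma> * bond_energy P fst snd h (?g z) (?g z))) \<partial>(?M \<Otimes>\<^sub>M ?M))"
    by (rule nn_integral_distr[OF g(2)]) (use m in simp)
  also have "\<dots> = (\<integral>\<^sup>+\<phi>. \<integral>\<^sup>+\<psi>. ennreal (exp (- \<gamma> * bond_energy P fst snd h (?g (\<phi>, \<psi>)) (?g (\<phi>, \<psi>)))) \<partial>?M \<partial>?M)"
    by (rule M.nn_integral_fst[symmetric]) (rule measurable_compose[OF g(2) m])
  finally show ?thesis
    unfolding energy two_sided_def I_def C_def ap_def .
qed

text \<open>Each factor in \<open>two_sided_Cauchy_Schwarz\<close> has the same data on both halves
  and no crossing field. Folding the field \<open>reflect_field \<theta> A h\<close>, or the one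
  built from \<open>V - A\<close>, produces exactly such data, so both factors are again partition
  functions.\<close>

lemma reflection_positivity:
  fixes h :: "'v \<times> 'v \<Rightarrow> 'b"
  assumes V: "finite V" and P: "P \<subseteq> V \<times> V" and r: "reflects V P \<theta> A"
  shows "(partition V P h)\<^sup>2 \<le> partition V P (reflect_field \<theta> A h) * partition V P (reflect_field \<theta> (V - A) h)"
proof -
  have A: "A \<subseteq> V" and \<theta>: "\<And>x. x \<in> V \<Longrightarrow> \<theta> x \<in> V \<and> \<theta> (\<theta> x) = x \<and> (\<theta> x \<in> A \<longleftrightarrow> x \<notin> A)"
    using r by (auto simp: reflects_def)
  have PV: "fst p \<in> V" "snd p \<in> V" if "p \<in> P" for p using that P by auto
  have fin: "finite P" "finite A" using A P V finite_subset by blast+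
  let ?I = "{p\<in>P. fst p \<in> A \<and> snd p \<in> A}" and ?C = "{p\<in>P. (fst p \<in> A) \<noteq> (snd p \<in> A)}"
  let ?ap = "\<lambda>p. if fst p \<in> A then fst p else snd p" and ?c = "\<lambda>p. if fst p \<in> A then h p else - h p"
  let ?h = "\<lambda>p. h (map_prod \<theta> \<theta> p)"
  have invol: "map_prod \<theta> \<theta> (map_prod \<theta> \<theta> p) = p" if "p \<in> P" for p
    using \<theta>[OF PV(1)[OF that]] \<theta>[OF PV(2)[OF that]] by (simp add: prod_eq_iff)
  have IA: "\<theta> (fst p) \<in> V" "\<theta> (snd p) \<in> V" "\<theta> (fst p) \<in> A \<longleftrightarrow> fst p \<notin> A" "\<theta> (snd p) \<in> A \<longleftrightarrow> snd p \<notin> A" if "p \<in> P" for p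
    using \<theta>[OF PV(1)[OF that]] \<theta>[OF PV(2)[OF that]] by auto
  have "(partition V P h)\<^sup>2 \<le> two_sided A ?I ?C ?ap h ?c h ?c * two_sided A ?I ?C ?ap ?h (\<lambda>_. 0) ?h (\<lambda>_. 0)"
    unfolding partition_eq_two_sided[OF V P r]
    by (rule two_sided_Cauchy_Schwarz) (use fin in \<open>auto\<close>)
  also have "two_sided A ?I ?C ?ap h ?c h ?c = partition V P (reflect_field \<theta> A h)"
    unfolding partition_eq_two_sided[OF V P r]
    by (rule two_sided_cong) (simp_all add: reflect_field_def invol IA)
  also have "two_sided A ?I ?C ?ap ?h (\<lambda>_. 0) ?h (\<lambda>_. 0) = partition V P (reflect_field \<theta> (V - A) h)"
    unfolding partition_eq_two_sided[OF V P r]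
    by (rule two_sided_cong) (auto simp: reflect_field_def invol IA PV)
  finally show ?thesis .
qed

end

section \<open>Gaussian domination and the infrared bound\<close>

context single_spin
begin

lemma prob_space_spins: "prob_space (Pi\<^sub>M V (\<lambda>_. \<rho>))"
  by (intro prob_space_PiM prob_\<rho>)

lemma integrable_weight:
  assumes "P \<subseteq> V \<times> V"
  shows "integrable (Pi\<^sub>M V (\<lambda>_. \<rho>)) (\<lambda>\<phi>. exp (- \<gamma> * bond_energy P fst snd h \<phi> \<phi>))"
proof -
  interpret M: prob_space "Pi\<^sub>M V (\<lambda>_. \<rho>)" by (rule prob_space_spins)
  have [measurable]: "(\<lambda>\<phi>. bond_energy P fst snd h \<phi> \<phi>) \<in> borel_measurable (Pi\<^sub>M V (\<lambda>_. \<rho>))"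
    by (rule measurable_bond_energy[OF assms])
  show ?thesis
    using \<gamma> by (intro M.integrable_const_bound[of _ 1]) (auto intro!: mult_nonneg_nonneg bond_energy_nonneg)
qed

lemma partition_eq_integral:
  assumes "P \<subseteq> V \<times> V"
  shows "partition V P h = ennreal (\<integral>\<phi>. exp (- \<gamma> * bond_energy P fst snd h \<phi> \<phi>) \<partial>(Pi\<^sub>M V (\<lambda>_. \<rho>)))"
  unfolding partition_def by (rule nn_integral_eq_integral[OF integrable_weight[OF assms]]) auto

lemma integral_weight_pos:
  assumes "P \<subseteq> V \<times> V"
  shows "(\<integral>\<phi>. exp (- \<gamma> * bond_energy P fst snd h \<phi> \<phi>) \<partial>(Pi\<^sub>M V (\<lambda>_. \<rho>))) > 0"
proof -
  interpret M: prob_space "Pi\<^sub>M V (\<lambda>_. \<rho>)" by (rule prob_space_spins)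
  have "(\<integral>\<phi>. exp (- \<gamma> * bond_energy P fst snd h \<phi> \<phi>) \<partial>(Pi\<^sub>M V (\<lambda>_. \<rho>))) \<noteq> 0" (is "?I \<noteq> 0")
  proof
    assume "(\<integral>\<phi>. exp (- \<gamma> * bond_energy P fst snd h \<phi> \<phi>) \<partial>(Pi\<^sub>M V (\<lambda>_. \<rho>))) = 0"
    then have "AE \<phi> in Pi\<^sub>M V (\<lambda>_. \<rho>). exp (- \<gamma> * bond_energy P fst snd h \<phi> \<phi>) = 0"
      by (subst (asm) integral_nonneg_eq_0_iff_AE[OF integrable_weight[OF assms]]) auto
    then have "AE \<phi> in Pi\<^sub>M V (\<lambda>_. \<rho>). False"
      by simp
    then show False by simp
  qed
  moreover have "?I \<ge> 0"
    by (intro integral_nonneg_AE) auto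
  ultimately show ?thesis
    by (metis less_le)
qed

text \<open>Among the fields with values in the finite set \<open>insert 0 (h ` P)\<close>, which reflection preserves,
  choose one that maximizes the partition function and, among those, has the most zeros. A reflection
  that cuts a bond where the field is nonzero would produce a maximizer with more zeros.\<close>

theorem gaussian_domination:
  fixes h :: "'v \<times> 'v \<Rightarrow> 'b"
  assumes V: "finite V" and P: "P \<subseteq> V \<times> V"
    and R: "\<And>p. p \<in> P \<Longrightarrow> \<exists>\<theta> A. reflects V P \<theta> A \<and> (fst p \<in> A) \<noteq> (snd p \<in> A)"
  shows "(\<integral>\<phi>. exp (- \<gamma> * bond_energy P fst snd h \<phi> \<phi>) \<partial>(Pi\<^sub>M V (\<lambda>_. \<rho>)))
    \<le> (\<integral>\<phi>. exp (- \<gamma> * bond_energy P fst snd (\<lambda>_. 0) \<phi> \<phi>) \<partial>(Pi\<^sub>M V (\<lambda>_. \<rho>)))"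
proof -
  define Z where "Z h = (\<integral>\<phi>. exp (- \<gamma> * bond_energy P fst snd h \<phi> \<phi>) \<partial>(Pi\<^sub>M V (\<lambda>_. \<rho>)))" for h
  have Z_pos: "Z h > 0" for h unfolding Z_def by (rule integral_weight_pos[OF P])
  have Z_cong: "Z g = Z g'" if "\<And>p. p \<in> P \<Longrightarrow> g p = g' p" for g g'
  proof -
    have "bond_energy P fst snd g = bond_energy P fst snd g'"
      using that by (auto simp: bond_energy_def fun_eq_iff intro!: sum.cong)
    then show ?thesis by (simp add: Z_def)
  qed
  have RP: "(Z g)\<^sup>2 \<le> Z (reflect_field \<theta> A g) * Z (reflect_field \<theta> (V - A) g)" if "reflects V P \<theta> A" for \<theta> A g
  proof -
    have "ennreal ((Z g)\<^sup>2) \<le> ennreal (Z (reflect_field \<theta> A g) * Z (reflect_field \<theta> (V - A) g))"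
      using reflection_positivity[OF V P that, of g]
      unfolding partition_eq_integral[OF P] Z_def[symmetric]
      by (simp add: ennreal_power ennreal_mult Z_pos[THEN less_imp_le])
    then show ?thesis
      using Z_pos by (simp add: ennreal_le_iff less_imp_le)
  qed
  have finP: "finite P" using P V finite_subset by blast
  define H where "H = P \<rightarrow>\<^sub>E insert 0 (h ` P)"
  define zeros where "zeros g = (\<Sum>p\<in>P. if g p = 0 then 1 else 0 :: nat)" for g :: "'v \<times> 'v \<Rightarrow> 'b"
  have finH: "finite H" unfolding H_def using finP by (intro finite_PiE) auto
  have hH: "restrict h P \<in> H" unfolding H_def by auto
  define m where "m = Max (Z ` H)"
  have le_m: "Z g \<le> m" if "g \<in> H" for g unfolding m_def using finH that by auto
  define H' where "H' = {g \<in> H. Z g = m}"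
  have "m \<in> Z ` H" unfolding m_def using finH hH by (intro Max_in) auto
  then have "H' \<noteq> {}" unfolding H'_def by auto
  moreover have "finite H'" unfolding H'_def using finH by auto
  ultimately have "Max (zeros ` H') \<in> zeros ` H'" by (intro Max_in) auto
  then obtain g where g: "g \<in> H'" and gmax: "Max (zeros ` H') = zeros g" by auto
  have zeros_le: "zeros g' \<le> zeros g" if "g' \<in> H'" for g'
    unfolding gmax[symmetric] using \<open>finite H'\<close> that by auto
  have "g p = 0" if p: "p \<in> P" for p
  proof (rule ccontr)
    assume "g p \<noteq> 0"
    obtain \<theta> A where r: "reflects V P \<theta> A" and cut: "(fst p \<in> A) \<noteq> (snd p \<in> A)"
      using R[OF p] by blast
    have \<theta>: "\<And>x. x \<in> V \<Longrightarrow> \<theta> x \<in> V \<and> \<theta> (\<theta> x) = x \<and> (\<theta> x \<in> A \<longleftrightarrow> x \<notin> A)"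
      and \<theta>P: "\<And>p. p \<in> P \<Longrightarrow> map_prod \<theta> \<theta> p \<in> P"
      using r by (auto simp: reflects_def)
    have PV: "fst q \<in> V" "snd q \<in> V" if "q \<in> P" for q using that P by auto
    define g1 where "g1 = restrict (reflect_field \<theta> A g) P"
    define g2 where "g2 = restrict (reflect_field \<theta> (V - A) g) P"
    have gv: "g q \<in> insert 0 (h ` P)" if "q \<in> P" for q
      using g that by (auto simp: H'_def H_def PiE_iff)
    have g12H: "g1 \<in> H" "g2 \<in> H"
      using gv \<theta>P unfolding g1_def g2_def H_def reflect_field_def by auto
    have "m\<^sup>2 \<le> Z g1 * Z g2"
    proof -
      have "Z g1 = Z (reflect_field \<theta> A g)" "Z g2 = Z (reflect_field \<theta> (V - A) g)"
        unfolding g1_def g2_def by (auto intro!: Z_cong)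
      then show ?thesis using RP[OF r, of g] g by (simp add: H'_def)
    qed
    moreover have "Z g1 \<le> m" "Z g2 \<le> m" "Z g1 > 0" "Z g2 > 0"
      using g12H le_m Z_pos by auto
    ultimately have "Z g1 = m" "Z g2 = m"
      by (smt (verit) mult_less_cancel_left_pos mult_less_cancel_right_pos power2_eq_square)+
    then have "g1 \<in> H'" "g2 \<in> H'" using g12H by (auto simp: H'_def)
    then have le: "zeros g1 + zeros g2 \<le> 2 * zeros g"
      using zeros_le[of g1] zeros_le[of g2] by linarith
    define z where "z x = (if x = 0 then 1 else 0 :: nat)" for x :: 'b
    \<comment> \<open>On an uncut bond, \<open>g1\<close> and \<open>g2\<close> take the values of
      \<open>g\<close> at \<open>q\<close> and at its image, in some order, so the two counts agree.
      On a cut bond both vanish and the right side is 2, which is strictly more at \<open>p\<close>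
      because \<open>g p\<close> is nonzero. Summing, with reflection permuting \<open>P\<close>,
      gives more zeros for \<open>g1\<close> and \<open>g2\<close> together than twice those of
      \<open>g\<close>.\<close>
    have g12: "z (g q) + z (g (map_prod \<theta> \<theta> q)) \<le> z (g1 q) + z (g2 q)" if q: "q \<in> P" for q
      using q PV[OF q] by (auto simp: g1_def g2_def reflect_field_def z_def)
    moreover have "z (g p) + z (g (map_prod \<theta> \<theta> p)) < z (g1 p) + z (g2 p)"
      using p cut PV[OF p] \<open>g p \<noteq> 0\<close> by (auto simp: g1_def g2_def reflect_field_def z_def)
    ultimately have "(\<Sum>q\<in>P. z (g q) + z (g (map_prod \<theta> \<theta> q))) < (\<Sum>q\<in>P. z (g1 q) + z (g2 q))"
      using p finP by (intro sum_strict_mono_ex1) auto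
    moreover have "(\<Sum>q\<in>P. z (g (map_prod \<theta> \<theta> q))) = (\<Sum>q\<in>P. z (g q))"
    proof (rule sum.reindex_bij_witness[of _ "map_prod \<theta> \<theta>" "map_prod \<theta> \<theta>"])
      fix q assume "q \<in> P"
      then show "map_prod \<theta> \<theta> q \<in> P" "map_prod \<theta> \<theta> (map_prod \<theta> \<theta> q) = q"
        using \<theta>P \<theta>[OF PV(1)[of q]] \<theta>[OF PV(2)[of q]] by (simp_all add: prod_eq_iff)
    qed (use \<theta>P \<theta> PV in \<open>simp_all add: prod_eq_iff\<close>)
    ultimately show False
      using le by (simp add: zeros_def z_def sum.distrib)
  qed
  then have "Z g = Z (\<lambda>_. 0)" by (intro Z_cong) auto
  moreover have "Z h = Z (restrict h P)" by (intro Z_cong) auto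
  moreover have "Z (restrict h P) \<le> Z g" using le_m[OF hH] g by (simp add: H'_def)
  ultimately show ?thesis unfolding Z_def by simp
qed

text \<open>For the field \<open>(t * k p) *\<^sub>R e\<close>, expanding the squares multiplies the
  weight by \<open>exp (2 * \<gamma> * t * X)\<close> and a constant. Adding the cases
  \<open>t\<close> and \<open>-t\<close> removes the linear term and leaves a hyperbolic cosine,
  whose lower bound by its quadratic part replaces differentiation under the integral. Comparing the
  coefficients of \<open>t\<^sup>2\<close> as \<open>t\<close> tends to 0 yields the factor
  \<open>1 / (2 * \<gamma>)\<close>.\<close>

theorem infrared_bound:
  fixes k :: "'v \<times> 'v \<Rightarrow> real" and e :: 'b
  assumes V: "finite V" and P: "P \<subseteq> V \<times> V"
    and R: "\<And>p. p \<in> P \<Longrightarrow> \<exists>\<theta> A. reflects V P \<theta> A \<and> (fst p \<in> A) \<noteq> (snd p \<in> A)"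
    and e: "norm e = 1"
  defines "w \<equiv> \<lambda>\<phi>. exp (- \<gamma> * bond_energy P fst snd (\<lambda>_. 0) \<phi> \<phi>)"
    and "X \<equiv> \<lambda>\<phi>. \<Sum>p\<in>P. k p * ((\<phi> (fst p) - \<phi> (snd p)) \<bullet> e)"
  shows "(\<integral>\<phi>. (X \<phi>)\<^sup>2 * w \<phi> \<partial>(Pi\<^sub>M V (\<lambda>_. \<rho>))) \<le> (\<Sum>p\<in>P. (k p)\<^sup>2) / (2 * \<gamma>) * (\<integral>\<phi>. w \<phi> \<partial>(Pi\<^sub>M V (\<lambda>_. \<rho>)))"
proof -
  let ?M = "Pi\<^sub>M V (\<lambda>_. \<rho>)"
  interpret M: prob_space ?M by (rule prob_space_spins)
  define K where "K = (\<Sum>p\<in>P. (k p)\<^sup>2)"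
  define Y where "Y t \<phi> = exp (- \<gamma> * bond_energy P fst snd (\<lambda>p. (t * k p) *\<^sub>R e) \<phi> \<phi>)" for t \<phi>
  have finP: "finite P" using P V finite_subset by blast
  have PV: "fst q \<in> V" "snd q \<in> V" if "q \<in> P" for q using that P by auto
  have Y_eq: "Y t \<phi> = w \<phi> * exp (2 * \<gamma> * t * X \<phi>) * exp (- \<gamma> * t\<^sup>2 * K)" for t \<phi>
  proof -
    have "bond_energy P fst snd (\<lambda>p. (t * k p) *\<^sub>R e) \<phi> \<phi>
      = (\<Sum>p\<in>P. (norm (\<phi> (fst p) - \<phi> (snd p) - 0))\<^sup>2 - 2 * t * (k p * ((\<phi> (fst p) - \<phi> (snd p)) \<bullet> e)) + t\<^sup>2 * (k p)\<^sup>2)"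
      unfolding bond_energy_def
    proof (intro sum.cong refl)
      fix p
      have "e \<bullet> e = 1" using e by (simp add: norm_eq_1)
      then show "(norm (\<phi> (fst p) - \<phi> (snd p) - (t * k p) *\<^sub>R e))\<^sup>2
        = (norm (\<phi> (fst p) - \<phi> (snd p) - 0))\<^sup>2 - 2 * t * (k p * ((\<phi> (fst p) - \<phi> (snd p)) \<bullet> e)) + t\<^sup>2 * (k p)\<^sup>2"
        unfolding power2_norm_eq_inner
        by (simp add: inner_diff_left inner_diff_right inner_commute power2_eq_square algebra_simps)
    qed
    also have "\<dots> = bond_energy P fst snd (\<lambda>_. 0) \<phi> \<phi> - 2 * t * X \<phi> + t\<^sup>2 * K"
      by (simp add: bond_energy_def X_def K_def sum.distrib sum_subtractf sum_distrib_left)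
    finally have eq: "bond_energy P fst snd (\<lambda>p. (t * k p) *\<^sub>R e) \<phi> \<phi>
        = bond_energy P fst snd (\<lambda>_. 0) \<phi> \<phi> - 2 * t * X \<phi> + t\<^sup>2 * K" .
    have "- \<gamma> * bond_energy P fst snd (\<lambda>p. (t * k p) *\<^sub>R e) \<phi> \<phi>
        = - \<gamma> * bond_energy P fst snd (\<lambda>_. 0) \<phi> \<phi> + 2 * \<gamma> * t * X \<phi> + - \<gamma> * t\<^sup>2 * K"
      unfolding eq by (simp add: algebra_simps)
    then show ?thesis
      unfolding Y_def w_def by (simp only: exp_add)
  qed
  have [measurable]: "w \<in> borel_measurable ?M" "X \<in> borel_measurable ?M"
  proof -
    show "w \<in> borel_measurable ?M"
      unfolding w_def using measurable_bond_energy[OF P, of "\<lambda>_. 0"] by measurable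
    show "X \<in> borel_measurable ?M"
      unfolding X_def
    proof (intro borel_measurable_sum)
      fix p assume "p \<in> P"
      then have "fst p \<in> V" "snd p \<in> V" using PV by auto
      note [measurable] = this[THEN measurable_spin]
      show "(\<lambda>\<phi>. k p * ((\<phi> (fst p) - \<phi> (snd p)) \<bullet> e)) \<in> borel_measurable ?M"
        by measurable
    qed
  qed
  have w01: "0 < w \<phi>" "w \<phi> \<le> 1" for \<phi>
    using \<gamma> by (auto simp: w_def intro!: mult_nonneg_nonneg bond_energy_nonneg)
  have Y_int: "integrable ?M (Y t)" for t
    unfolding Y_def by (rule integrable_weight[OF P])
  have Y_le: "integral\<^sup>L ?M (Y t) \<le> integral\<^sup>L ?M w" for t
    unfolding Y_def w_def by (rule gaussian_domination[OF V P R])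
  have Y_bound: "Y t \<phi> \<le> 1" for t \<phi>
    using \<gamma> by (auto simp: Y_def intro!: mult_nonneg_nonneg bond_energy_nonneg)
  \<comment> \<open>The power series of cosh has nonnegative terms; the partial sum over
    \<open>n < 3\<close> is \<open>1 + u\<^sup>2 / 2\<close>.\<close>
  have cosh_bound: "exp u + exp (- u) \<ge> 2 + u\<^sup>2" for u :: real
  proof -
    have "(\<Sum>n<3. if even n then u ^ n /\<^sub>R fact n else 0) \<le> (\<Sum>n. if even n then u ^ n /\<^sub>R fact n else 0)"
      using sums_summable[OF cosh_converges[of u]] by (intro sum_le_suminf) auto
    also have "\<dots> = cosh u"
      using sums_unique[OF cosh_converges[of u]] by simp
    finally show ?thesis
      by (simp add: cosh_field_def eval_nat_numeral)
  qed
  have pw: "w \<phi> * (2 + (2 * \<gamma> * t)\<^sup>2 * (X \<phi>)\<^sup>2) \<le> exp (\<gamma> * t\<^sup>2 * K) * (Y t \<phi> + Y (- t) \<phi>)" for t \<phi>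
  proof -
    have "exp (\<gamma> * t\<^sup>2 * K) * (Y t \<phi> + Y (- t) \<phi>)
        = w \<phi> * (exp (2 * \<gamma> * t * X \<phi>) + exp (- (2 * \<gamma> * t * X \<phi>)))"
      by (simp add: Y_eq exp_minus field_simps)
    moreover have "2 + (2 * \<gamma> * t)\<^sup>2 * (X \<phi>)\<^sup>2 \<le> exp (2 * \<gamma> * t * X \<phi>) + exp (- (2 * \<gamma> * t * X \<phi>))"
      using cosh_bound[of "2 * \<gamma> * t * X \<phi>"] by (simp add: power_mult_distrib)
    ultimately show ?thesis using w01[of \<phi>] by (simp add: mult_left_mono)
  qed
  have w_int: "integrable ?M w" unfolding w_def by (rule integrable_weight[OF P])
  \<comment> \<open>The spins may be unbounded under a general \<open>\<rho>\<close>, so boundedness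
    of \<open>X\<^sup>2 * w\<close> is read off from \<open>pw\<close> at \<open>t = 1\<close>,
    where both terms \<open>Y\<close> are at most 1.\<close>
  have int: "integrable ?M (\<lambda>\<phi>. (X \<phi>)\<^sup>2 * w \<phi>)"
  proof (rule M.integrable_const_bound[of _ "exp (\<gamma> * K) * 2 / (2 * \<gamma>)\<^sup>2"])
    have "(X \<phi>)\<^sup>2 * w \<phi> \<le> exp (\<gamma> * K) * 2 / (2 * \<gamma>)\<^sup>2" for \<phi>
    proof -
      have "w \<phi> * ((2 * \<gamma>)\<^sup>2 * (X \<phi>)\<^sup>2) \<le> w \<phi> * (2 + (2 * \<gamma>)\<^sup>2 * (X \<phi>)\<^sup>2)"
        using w01[of \<phi>] by (intro mult_left_mono) auto
      also have "\<dots> \<le> exp (\<gamma> * K) * (Y 1 \<phi> + Y (- 1) \<phi>)"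
        using pw[of \<phi> 1] by simp
      also have "\<dots> \<le> exp (\<gamma> * K) * 2"
        using Y_bound[of 1 \<phi>] Y_bound[of "-1" \<phi>] by (intro mult_left_mono) auto
      finally show ?thesis using \<gamma> by (simp add: field_simps)
    qed
    then show "AE \<phi> in ?M. norm ((X \<phi>)\<^sup>2 * w \<phi>) \<le> exp (\<gamma> * K) * 2 / (2 * \<gamma>)\<^sup>2"
      using w01 by (simp add: less_imp_le)
  qed measurable
  define W where "W = integral\<^sup>L ?M w"
  define E where "E = (\<integral>\<phi>. (X \<phi>)\<^sup>2 * w \<phi> \<partial>?M)"
  have W0: "W \<ge> 0" unfolding W_def using w01 by (intro integral_nonneg_AE) (auto simp: less_imp_le)
  have main: "(2 * \<gamma> * t)\<^sup>2 * E \<le> 2 * (exp (\<gamma> * t\<^sup>2 * K) - 1) * W" for t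
  proof -
    have "2 * W + (2 * \<gamma> * t)\<^sup>2 * E = (\<integral>\<phi>. 2 * w \<phi> + (2 * \<gamma> * t)\<^sup>2 * ((X \<phi>)\<^sup>2 * w \<phi>) \<partial>?M)"
      unfolding W_def E_def using w_int int by simp
    also have "\<dots> \<le> (\<integral>\<phi>. exp (\<gamma> * t\<^sup>2 * K) * (Y t \<phi> + Y (- t) \<phi>) \<partial>?M)"
    proof (rule integral_mono)
      show "2 * w \<phi> + (2 * \<gamma> * t)\<^sup>2 * ((X \<phi>)\<^sup>2 * w \<phi>) \<le> exp (\<gamma> * t\<^sup>2 * K) * (Y t \<phi> + Y (- t) \<phi>)" for \<phi>
        using pw[of \<phi> t] by (simp add: algebra_simps)
    qed (use w_int int Y_int in auto)
    also have "\<dots> = exp (\<gamma> * t\<^sup>2 * K) * (integral\<^sup>L ?M (Y t) + integral\<^sup>L ?M (Y (- t)))"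
      using Y_int[of t] Y_int[of "-t"] by simp
    also have "\<dots> \<le> exp (\<gamma> * t\<^sup>2 * K) * (W + W)"
      using Y_le[of t] Y_le[of "-t"] by (intro mult_left_mono) (auto simp: W_def)
    finally show ?thesis by (simp add: algebra_simps)
  qed
  \<comment> \<open>With \<open>s = \<gamma> * t\<^sup>2 * K\<close> at most 1,
    \<open>exp s - 1\<close> is at most \<open>s + s\<^sup>2\<close>; dividing \<open>main\<close>
    by \<open>2 * \<gamma> * t\<^sup>2\<close> leaves an error that vanishes with
    \<open>t\<close>.\<close>
  have ev: "2 * \<gamma> * E \<le> K * (1 + \<gamma> * t\<^sup>2 * K) * W" if "t > 0" "\<gamma> * t\<^sup>2 * K < 1" for t
  proof -
    define s where "s = \<gamma> * t\<^sup>2 * K"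
    have K0: "K \<ge> 0" unfolding K_def by (intro sum_nonneg) auto
    have "exp s \<le> 1 + s + s\<^sup>2"
      using that \<gamma> K0 by (intro exp_bound) (auto simp: s_def)
    then have "2 * (exp s - 1) * W \<le> 2 * (s + s\<^sup>2) * W"
      using W0 by (intro mult_right_mono) auto
    with main[of t] have "(2 * \<gamma> * t\<^sup>2) * (2 * \<gamma> * E) \<le> (2 * \<gamma> * t\<^sup>2) * (K * (1 + \<gamma> * t\<^sup>2 * K) * W)"
      by (simp add: s_def power2_eq_square algebra_simps)
    then show ?thesis using that \<gamma> by (subst (asm) mult_le_cancel_left_pos) auto
  qed
  have "((\<lambda>t. \<gamma> * t\<^sup>2 * K) \<longlongrightarrow> \<gamma> * 0\<^sup>2 * K) (at_right 0)"
    by (intro tendsto_intros)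
  then have "\<forall>\<^sub>F t in at_right 0. \<gamma> * t\<^sup>2 * K < 1"
    by (rule order_tendstoD) simp
  then have "\<forall>\<^sub>F t in at_right 0. 2 * \<gamma> * E \<le> K * (1 + \<gamma> * t\<^sup>2 * K) * W"
    using eventually_at_right_less[of 0] by eventually_elim (rule ev)
  moreover have "((\<lambda>t. K * (1 + \<gamma> * t\<^sup>2 * K) * W) \<longlongrightarrow> K * (1 + \<gamma> * 0\<^sup>2 * K) * W) (at_right 0)"
    by (intro tendsto_intros)
  ultimately have "2 * \<gamma> * E \<le> K * (1 + \<gamma> * 0\<^sup>2 * K) * W"
    by (intro tendsto_lowerbound) auto
  then show "(\<integral>\<phi>. (X \<phi>)\<^sup>2 * w \<phi> \<partial>?M) \<le> (\<Sum>p\<in>P. (k p)\<^sup>2) / (2 * \<gamma>) * (\<integral>\<phi>. w \<phi> \<partial>?M)"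
    using \<gamma> by (simp add: E_def K_def W_def field_simps power2_eq_square)
qed

end

section \<open>Reflections of the torus\<close>

lemma finite_torus [simp]: "finite (torus L :: (int ^ 'd) set)"
proof -
  have "torus L \<subseteq> (\<lambda>f. \<chi> i. f i) ` (UNIV \<rightarrow>\<^sub>E {- int L..int L} :: ('d \<Rightarrow> int) set)"
  proof
    fix x :: "int ^ 'd" assume "x \<in> torus L"
    then have "- real L \<le> real_of_int (x $ i)" "real_of_int (x $ i) \<le> real L" for i
      by (auto simp: torus_def dest!: spec[of _ i])
    then have "- int L \<le> x $ i \<and> x $ i \<le> int L" for i
      by (metis of_int_le_iff of_int_minus of_int_of_nat_eq)
    then have "(\<lambda>i. x $ i) \<in> UNIV \<rightarrow>\<^sub>E {- int L..int L}"
      by auto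
    moreover have "x = (\<chi> i. x $ i)" by simp
    ultimately show "x \<in> (\<lambda>f. \<chi> i. f i) ` (UNIV \<rightarrow>\<^sub>E {- int L..int L})"
      by blast
  qed
  then show ?thesis
    by (rule finite_subset) (intro finite_imageI finite_PiE, auto)
qed

lemma torus_rep_eq_iff:
  assumes "L > 0"
  shows "torus_rep L x = y \<longleftrightarrow> y \<in> torus L \<and> (\<forall>i. [y $ i = x $ i] (mod int L))"
  using assms torus_rep_in_torus[OF assms, of x] torus_rep_cong[of L x]
  by (metis cong_sym cong_trans torus_cong_unique)

lemma torus_rep_id: "L > 0 \<Longrightarrow> x \<in> torus L \<Longrightarrow> torus_rep L x = x"
  by (subst torus_rep_eq_iff) auto

lemma torus_rep_eqI:
  assumes "\<And>i. [x $ i = y $ i] (mod int L)"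
  shows "torus_rep L x = torus_rep L y"
proof -
  have "(int L div 2 - x $ i) mod int L = (int L div 2 - y $ i) mod int L" for i
    using assms[of i] by (metis cong_def cong_diff cong_refl)
  then show ?thesis by (simp add: torus_rep_def)
qed

definition torus_pairs :: "nat \<Rightarrow> ((int ^ 'd) \<times> (int ^ 'd)) set" where
  "torus_pairs L = {(x, y) \<in> torus L \<times> torus L. {x, y} \<in> torus_edges L}"

lemma torus_pairs_subset: "torus_pairs L \<subseteq> torus L \<times> torus L"
  by (auto simp: torus_pairs_def)

lemma finite_torus_pairs [simp]: "finite (torus_pairs L)"
  by (rule finite_subset[OF torus_pairs_subset]) simp

lemma torus_pairs_iff:
  assumes "L > 0"
  shows "(x, y) \<in> torus_pairs L \<longleftrightarrow> x \<in> torus L \<and> y \<in> torus L \<and>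
    (\<exists>i. torus_rep L (x + axis i 1) = y \<or> torus_rep L (y + axis i 1) = x)"
  by (auto simp: torus_pairs_def torus_edges_def doubleton_eq_iff)

text \<open>The mirror is the hyperplane where coordinate \<open>i\<close> equals
  \<open>c + 1/2\<close>, so it exchanges the layers \<open>c\<close> and
  \<open>c + 1\<close>.\<close>

definition torus_reflection :: "nat \<Rightarrow> 'd \<Rightarrow> int \<Rightarrow> int ^ 'd \<Rightarrow> int ^ 'd" where
  "torus_reflection L i c z = torus_rep L (\<chi> j. if j = i then 2 * c + 1 - z $ j else z $ j)"

text \<open>For even \<open>L\<close>, these are the \<open>L / 2\<close> layers
  \<open>c + 1, ..., c + L / 2\<close> in direction \<open>i\<close>, taken modulo
  \<open>L\<close>.\<close>

definition torus_half :: "nat \<Rightarrow> 'd \<Rightarrow> int \<Rightarrow> (int ^ 'd) set" where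
  "torus_half L i c = {z \<in> torus L. 2 * ((z $ i - c - 1) mod int L) < int L}"

lemma torus_reflection_cong:
  "[torus_reflection L i c z $ j = (if j = i then 2 * c + 1 - z $ j else z $ j)] (mod int L)"
  unfolding torus_reflection_def using torus_rep_cong[of L _ j] by (metis (no_types, lifting) vec_lambda_beta)

text \<open>In terms of the layer index \<open>m = (z $ i - c - 1) mod L\<close> the reflection is
  the map from \<open>m\<close> to \<open>L - 1 - m\<close>, which exchanges the lower and upper
  \<open>L / 2\<close> indices. Only bonds in direction \<open>i\<close> change \<open>m\<close>,
  and those that change halves are bisected by a mirror.\<close>

lemma reflects_torus:
  assumes L: "L > 0" "even L"
  shows "reflects (torus L) (torus_pairs L) (torus_reflection L i c) (torus_half L i c :: (int ^ 'd) set)"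
proof -
  let ?\<theta> = "torus_reflection L i c :: int ^ 'd \<Rightarrow> int ^ 'd" and ?A = "torus_half L i c :: (int ^ 'd) set"
  obtain h :: int where h: "int L = 2 * h" using L(2) by (metis evenE of_nat_mult of_nat_numeral)
  have h0: "h > 0" using L h by linarith
  have \<theta>T: "?\<theta> z \<in> torus L" for z
    unfolding torus_reflection_def by (rule torus_rep_in_torus[OF L(1)])
  note \<theta>c = torus_reflection_cong[of L i c]
  have inv: "?\<theta> (?\<theta> z) = z" if "z \<in> torus L" for z
  proof (rule torus_cong_unique[OF \<theta>T that])
    fix j
    have "[?\<theta> (?\<theta> z) $ j = (if j = i then 2 * c + 1 - ?\<theta> z $ j else ?\<theta> z $ j)] (mod int L)"
      by (rule \<theta>c)
    also have "[(if j = i then 2 * c + 1 - ?\<theta> z $ j else ?\<theta> z $ j) =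
        (if j = i then 2 * c + 1 - (2 * c + 1 - z $ j) else z $ j)] (mod int L)"
      using cong_diff[OF cong_refl[of "2 * c + 1"] \<theta>c[of z j]] \<theta>c[of z j] by auto
    finally show "[?\<theta> (?\<theta> z) $ j = z $ j] (mod int L)" by (auto split: if_splits)
  qed
  have half: "?\<theta> z \<in> ?A \<longleftrightarrow> z \<notin> ?A" if "z \<in> torus L" for z
  proof -
    define m where "m = (z $ i - c - 1) mod int L"
    have m: "0 \<le> m" "m < int L" using L by (auto simp: m_def)
    have "[?\<theta> z $ i - c - 1 = 2 * c + 1 - z $ i - c - 1] (mod int L)"
      using \<theta>c[of z i] by (intro cong_diff) auto
    also have "2 * c + 1 - z $ i - c - 1 = - 1 - (z $ i - c - 1)" by simp
    also have "[- 1 - (z $ i - c - 1) = - 1 - m] (mod int L)"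
      unfolding m_def by (intro cong_diff) (auto simp: cong_def)
    also have "[- 1 - m = int L - 1 - m] (mod int L)"
      by (simp add: cong_iff_dvd_diff)
    finally have "(?\<theta> z $ i - c - 1) mod int L = (int L - 1 - m) mod int L"
      by (simp add: cong_def)
    also have "\<dots> = int L - 1 - m" using m by simp
    finally have "?\<theta> z \<in> ?A \<longleftrightarrow> 2 * (int L - 1 - m) < int L"
      using \<theta>T[of z] by (simp only: torus_half_def mem_Collect_eq simp_thms)
    moreover have "z \<in> ?A \<longleftrightarrow> 2 * m < int L"
      using that by (simp only: torus_half_def mem_Collect_eq simp_thms m_def)
    ultimately show ?thesis
      using m h by presburger
  qed
  have step: "torus_rep L (?\<theta> u + axis j 1) = ?\<theta> v" if "v = torus_rep L (u + axis j 1)" "j \<noteq> i" for u v j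
    unfolding torus_reflection_def[of L i c v]
  proof (rule torus_rep_eqI)
    fix l
    have v: "[u $ l + axis j 1 $ l = v $ l] (mod int L)"
      unfolding that(1) using torus_rep_cong[of L "u + axis j 1" l] by (simp add: cong_sym)
    have "[?\<theta> u $ l + axis j 1 $ l = (if l = i then 2 * c + 1 - u $ l else u $ l) + axis j 1 $ l] (mod int L)"
      by (intro cong_add \<theta>c cong_refl)
    also have "(if l = i then 2 * c + 1 - u $ l else u $ l) + axis j 1 $ l =
        (if l = i then 2 * c + 1 - (u $ l + axis j 1 $ l) else u $ l + axis j 1 $ l)"
      using that(2) by (auto simp: axis_def)
    also have "[\<dots> = (if l = i then 2 * c + 1 - v $ l else v $ l)] (mod int L)"
      using cong_diff[OF cong_refl[of "2 * c + 1"] v] v by auto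
    finally show "[(?\<theta> u + axis j 1) $ l = (\<chi> j. if j = i then 2 * c + 1 - v $ j else v $ j) $ l] (mod int L)"
      by simp
  qed
  \<comment> \<open>Steps in direction \<open>i\<close> are reversed by the reflection. The image of
    such a bond is therefore a bond with the opposite orientation, and \<open>torus_pairs\<close>
    contains both orientations.\<close>
  have step': "torus_rep L (?\<theta> v + axis i 1) = ?\<theta> u" if "v = torus_rep L (u + axis i 1)" for u v
    unfolding torus_reflection_def[of L i c u]
  proof (rule torus_rep_eqI)
    fix l
    have v: "[v $ l = u $ l + axis i 1 $ l] (mod int L)"
      unfolding that using torus_rep_cong[of L "u + axis i 1" l] by simp
    have "[?\<theta> v $ l + axis i 1 $ l = (if l = i then 2 * c + 1 - v $ l else v $ l) + axis i 1 $ l] (mod int L)"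
      by (intro cong_add \<theta>c cong_refl)
    also have "[(if l = i then 2 * c + 1 - v $ l else v $ l) + axis i 1 $ l =
        (if l = i then 2 * c + 1 - (u $ l + axis i 1 $ l) else u $ l + axis i 1 $ l) + axis i 1 $ l] (mod int L)"
      using cong_diff[OF cong_refl[of "2 * c + 1"] v] v by (intro cong_add cong_refl) auto
    also have "(if l = i then 2 * c + 1 - (u $ l + axis i 1 $ l) else u $ l + axis i 1 $ l) + axis i 1 $ l
        = (if l = i then 2 * c + 1 - u $ l else u $ l)"
      by (auto simp: axis_def)
    finally show "[(?\<theta> v + axis i 1) $ l = (\<chi> j. if j = i then 2 * c + 1 - u $ j else u $ j) $ l] (mod int L)"
      by simp
  qed
  have pairs: "(?\<theta> u, ?\<theta> v) \<in> torus_pairs L" if "(u, v) \<in> torus_pairs L" for u v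
    using that \<theta>T step step' unfolding torus_pairs_iff[OF L(1)] by metis
  have cross: "v = ?\<theta> u" if "u \<in> torus L" "v = torus_rep L (u + axis j 1)" "(u \<in> ?A) \<noteq> (v \<in> ?A)" for u v j
  proof -
    have vT: "v \<in> torus L" using that(2) torus_rep_in_torus[OF L(1)] by auto
    have v: "[v $ l = u $ l + axis j 1 $ l] (mod int L)" for l
      unfolding that using torus_rep_cong[of L "u + axis j 1" l] by simp
    define m where "m = (u $ i - c - 1) mod int L"
    have m: "0 \<le> m" "m < int L" using L by (auto simp: m_def)
    have "(v $ i - c - 1) mod int L = (u $ i + axis j 1 $ i - c - 1) mod int L"
      using v[of i] by (metis cong_def cong_diff cong_refl)
    also have "\<dots> = (m + axis j 1 $ i) mod int L"
      unfolding m_def by (subst mod_add_left_eq) (simp add: algebra_simps)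
    finally have vm: "(v $ i - c - 1) mod int L = (m + axis j 1 $ i) mod int L" .
    have "j = i"
    proof (rule ccontr)
      assume "j \<noteq> i"
      then have "(v $ i - c - 1) mod int L = m" using vm m by (simp add: axis_def)
      then show False using that vT unfolding torus_half_def m_def by auto
    qed
    then have vm: "(v $ i - c - 1) mod int L = (if m = int L - 1 then 0 else m + 1)"
      using vm m by (auto simp: axis_def)
    \<comment> \<open>On a cycle the reflection has two mirrors: the step wraps around from
      \<open>L - 1\<close> to 0, or goes from \<open>L / 2 - 1\<close> to \<open>L / 2\<close>. In
      both cases \<open>L\<close> divides \<open>2 * m + 2\<close>, which makes the two ends of the
      bond mirror images modulo \<open>L\<close>.\<close>
    have "m = int L - 1 \<or> 2 * m + 2 = int L"
      using that(1,3) vT m h unfolding torus_half_def m_def[symmetric] mem_Collect_eq vm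
      by (auto split: if_splits)
    then have "int L dvd 2 * m + 2" by auto
    moreover have "int L dvd 2 * (u $ i - c - 1 - m)"
      unfolding m_def by (simp add: minus_mod_eq_mult_div)
    ultimately have "int L dvd 2 * (u $ i - c - 1 - m) + (2 * m + 2)"
      by (rule dvd_add[rotated])
    then have d: "int L dvd 2 * u $ i - 2 * c" by (simp add: algebra_simps)
    show ?thesis
    proof (rule torus_cong_unique[OF vT \<theta>T])
      fix l
      have "[?\<theta> u $ l = (if l = i then 2 * c + 1 - u $ l else u $ l)] (mod int L)" by (rule \<theta>c)
      also have "[(if l = i then 2 * c + 1 - u $ l else u $ l) = u $ l + axis j 1 $ l] (mod int L)"
        using d \<open>j = i\<close> by (auto simp: axis_def cong_iff_dvd_diff algebra_simps dvd_diff_commute)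
      also have "[u $ l + axis j 1 $ l = v $ l] (mod int L)" using v cong_sym by blast
      finally show "[v $ l = ?\<theta> u $ l] (mod int L)" by (rule cong_sym)
    qed
  qed
  have "v = ?\<theta> u" if "(u, v) \<in> torus_pairs L" "(u \<in> ?A) \<noteq> (v \<in> ?A)" for u v
  proof -
    have "u \<in> torus L" "v \<in> torus L" using that torus_pairs_subset by blast+
    then show ?thesis
      using that cross[of u v] cross[of v u] inv[of v] unfolding torus_pairs_iff[OF L(1)] by metis
  qed
  then show ?thesis
    using inv half pairs \<theta>T by (auto simp: reflects_def torus_half_def)
qed

text \<open>For a bond from \<open>u\<close> one step up in direction \<open>i\<close>, the mirror
  with \<open>c = u $ i\<close> passes through its midpoint: \<open>u\<close> has layer index
  \<open>L - 1\<close> and the other end has index 0.\<close>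

lemma torus_reflection_cutting:
  assumes L: "L > 0" "even L" and p: "p \<in> (torus_pairs L :: ((int ^ 'd) \<times> (int ^ 'd)) set)"
  shows "\<exists>\<theta> A. reflects (torus L) (torus_pairs L) \<theta> A \<and> (fst p \<in> A) \<noteq> (snd p \<in> A)"
proof -
  have L2: "2 \<le> int L" using L by (auto elim: evenE)
  have *: "u \<notin> torus_half L i (u $ i)" "v \<in> torus_half L i (u $ i)"
    if "v = torus_rep L (u + axis i 1)" for u v :: "int ^ 'd" and i
  proof -
    have "(- 1) mod int L = int L - 1" using L2 by (simp add: zmod_minus1)
    then show "u \<notin> torus_half L i (u $ i)" using L2 by (simp add: torus_half_def)
    have "[v $ i = u $ i + 1] (mod int L)"
      unfolding that using torus_rep_cong[of L "u + axis i 1" i] by simp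
    then have "(v $ i - u $ i - 1) mod int L = 0"
      by (simp add: cong_iff_dvd_diff algebra_simps)
    then show "v \<in> torus_half L i (u $ i)"
      using L torus_rep_in_torus[OF L(1)] by (simp add: torus_half_def that)
  qed
  obtain u v where uv: "p = (u, v)" by (cases p)
  then obtain i where "v = torus_rep L (u + axis i 1) \<or> u = torus_rep L (v + axis i 1)"
    using p torus_pairs_iff[OF L(1), of u v] by auto
  then show ?thesis
    using * reflects_torus[OF L] uv by (metis fst_conv snd_conv)
qed

section \<open>Flows of bounded energy\<close>

text \<open>A signed mass distribution is encoded by its action \<open>X\<close> on test functions.
  Requiring the identity for every \<open>f\<close> says that the divergence of \<open>k\<close> is
  \<open>X\<close>; for \<open>X f = f x - f y\<close> this is a unit flow from \<open>x\<close> to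
  \<open>y\<close>. The bound is on the square root of the energy, so that costs add by Minkowski's
  inequality when flows are superposed.\<close>

definition has_flow :: "nat \<Rightarrow> ((int ^ 'd \<Rightarrow> real) \<Rightarrow> real) \<Rightarrow> real \<Rightarrow> bool" where
  "has_flow L X r \<longleftrightarrow> (\<exists>k. (\<forall>f. X f = (\<Sum>p\<in>torus_pairs L. k p * (f (fst p) - f (snd p))))
     \<and> L2_set k (torus_pairs L) \<le> r)"

lemma has_flow_0: "0 \<le> r \<Longrightarrow> has_flow L (\<lambda>_. 0) r"
  unfolding has_flow_def by (rule exI[of _ "\<lambda>_. 0"]) (simp add: L2_set_def)

lemma has_flow_mono: "has_flow L X r \<Longrightarrow> r \<le> s \<Longrightarrow> has_flow L X s"
  unfolding has_flow_def by force

lemma has_flow_add: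
  assumes "has_flow L X r" "has_flow L Y s"
  shows "has_flow L (\<lambda>f. X f + Y f) (r + s)"
proof -
  obtain k l where k: "\<And>f. X f = (\<Sum>p\<in>torus_pairs L. k p * (f (fst p) - f (snd p)))" "L2_set k (torus_pairs L) \<le> r"
    and l: "\<And>f. Y f = (\<Sum>p\<in>torus_pairs L. l p * (f (fst p) - f (snd p)))" "L2_set l (torus_pairs L) \<le> s"
    using assms unfolding has_flow_def by blast
  show ?thesis
    unfolding has_flow_def
  proof (intro exI conjI allI)
    show "X f + Y f = (\<Sum>p\<in>torus_pairs L. (k p + l p) * (f (fst p) - f (snd p)))" for f
      unfolding k l by (simp add: distrib_right sum.distrib)
    show "L2_set (\<lambda>p. k p + l p) (torus_pairs L) \<le> r + s"
      using L2_set_triangle_ineq[of k l "torus_pairs L"] k l by linarith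
  qed
qed

lemma has_flow_scale:
  assumes "has_flow L X r"
  shows "has_flow L (\<lambda>f. c * X f) (\<bar>c\<bar> * r)"
proof -
  obtain k where k: "\<And>f. X f = (\<Sum>p\<in>torus_pairs L. k p * (f (fst p) - f (snd p)))" "L2_set k (torus_pairs L) \<le> r"
    using assms unfolding has_flow_def by blast
  show ?thesis
    unfolding has_flow_def
  proof (intro exI conjI allI)
    show "c * X f = (\<Sum>p\<in>torus_pairs L. (c * k p) * (f (fst p) - f (snd p)))" for f
      unfolding k by (simp add: sum_distrib_left mult_ac)
    have "L2_set (\<lambda>p. c * k p) (torus_pairs L) = \<bar>c\<bar> * L2_set k (torus_pairs L)"
      by (simp add: L2_set_def power_mult_distrib real_sqrt_mult flip: sum_distrib_left)
    then show "L2_set (\<lambda>p. c * k p) (torus_pairs L) \<le> \<bar>c\<bar> * r"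
      using k(2) by (simp add: mult_left_mono)
  qed
qed

lemma has_flow_swap: "has_flow L (\<lambda>f. X f - Y f) r \<Longrightarrow> has_flow L (\<lambda>f. Y f - X f) r"
  using has_flow_scale[of L "\<lambda>f. X f - Y f" r "- 1"] by simp

lemma has_flow_trans:
  assumes "has_flow L (\<lambda>f. X f - Y f) r" "has_flow L (\<lambda>f. Y f - Z f) s"
  shows "has_flow L (\<lambda>f. X f - Z f) (r + s)"
  using has_flow_add[OF assms] by simp

lemma has_flow_sum:
  assumes "finite S" "\<And>i. i \<in> S \<Longrightarrow> has_flow L (X i) (r i)"
  shows "has_flow L (\<lambda>f. \<Sum>i\<in>S. X i f) (\<Sum>i\<in>S. r i)"
  using assms
proof (induction S rule: finite_induct)
  case empty
  then show ?case using has_flow_0[of 0 L] by simp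
next
  case (insert i S)
  then show ?case using has_flow_add[of L "X i" "r i" "\<lambda>f. \<Sum>i\<in>S. X i f" "\<Sum>i\<in>S. r i"] by simp
qed

section \<open>Uniform mass distributions on boxes and the cost of moving them\<close>

definition int_box :: "nat \<Rightarrow> (int ^ 'd) set" where
  "int_box n = {u. \<forall>i. 0 \<le> u $ i \<and> u $ i < int n}"

lemma bij_betw_int_box: "bij_betw (\<lambda>f. \<chi> i. int (f i)) (UNIV \<rightarrow>\<^sub>E {..<n}) (int_box n :: (int ^ 'd) set)"
proof (rule bij_betw_byWitness[of _ "\<lambda>u i. nat (u $ i)"])
  show "(\<lambda>f. \<chi> i. int (f i)) ` (UNIV \<rightarrow>\<^sub>E {..<n}) \<subseteq> (int_box n :: (int ^ 'd) set)"
    by (auto simp: int_box_def PiE_iff)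
  show "(\<lambda>u i. nat (u $ i)) ` (int_box n :: (int ^ 'd) set) \<subseteq> UNIV \<rightarrow>\<^sub>E {..<n}"
    by (auto simp: int_box_def PiE_iff) (metis nat_less_iff)
qed (auto simp: int_box_def vec_eq_iff)

lemma card_int_box: "card (int_box n :: (int ^ 'd) set) = n ^ CARD('d)"
  using bij_betw_same_card[OF bij_betw_int_box[of n, where 'd = 'd]] by (simp add: card_PiE)

lemma finite_int_box [simp]: "finite (int_box n :: (int ^ 'd) set)"
  using bij_betw_finite[OF bij_betw_int_box[of n, where 'd = 'd]] by (simp add: finite_PiE)

definition box_average :: "nat \<Rightarrow> nat \<Rightarrow> int ^ 'd \<Rightarrow> (int ^ 'd \<Rightarrow> real) \<Rightarrow> real" where
  "box_average L n z f = (\<Sum>u\<in>int_box n. f (torus_rep L (z + u))) / real n ^ CARD('d)"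

text \<open>Moving each point of the box along a straight path of \<open>s\<close> steps gives a flow that
  has total mass \<open>s\<close> and is at most \<open>s / n ^ d\<close> on each edge, hence has energy at most
  \<open>s\<^sup>2 / n ^ d\<close>.\<close>

lemma has_flow_box_shift_pos:
  fixes z :: "int ^ 'd"
  assumes L: "L > 0" and n: "1 \<le> n" "n \<le> L" and s: "s \<le> n" and d: "3 \<le> CARD('d)"
  shows "has_flow L (\<lambda>f. box_average L n z f - box_average L n (z + axis i (int s)) f) (1 / sqrt (real n))"
proof -
  define N where "N = real n ^ CARD('d)"
  have N0: "N > 0" using n by (simp add: N_def)
  define T where "T x = torus_rep L (x + axis i 1)" for x :: "int ^ 'd"
  define B where "B = (int_box n :: (int ^ 'd) set) \<times> {..<s}"
  define pt where "pt = (\<lambda>(u, t). torus_rep L (z + u + axis i (int t)))"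
  \<comment> \<open>\<open>pt (u, t)\<close> is the position after \<open>t\<close> steps of the
    path that starts at \<open>z + u\<close>. Since every path moves only in direction
    \<open>i\<close>, the flow sits on the pairs \<open>(x, T x)\<close>, and \<open>w x\<close> is
    the number of visits to \<open>x\<close> divided by the volume of the box.\<close>
  define w where "w x = real (card {b \<in> B. pt b = x}) / N" for x
  define k where "k p = (if snd p = T (fst p) then w (fst p) else 0)" for p
  have finB: "finite B" by (simp add: B_def)
  have ptT: "pt ` B \<subseteq> torus L"
    using torus_rep_in_torus[OF L] by (auto simp: pt_def)
  have T_pt: "T (pt (u, t)) = torus_rep L (z + u + axis i (int (Suc t)))" for u t
    unfolding T_def pt_def case_prod_conv
  proof (rule torus_rep_eqI)
    fix l
    have "[torus_rep L (z + u + axis i (int t)) $ l + axis i 1 $ l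
        = (z + u + axis i (int t)) $ l + axis i 1 $ l] (mod int L)"
      by (intro cong_add torus_rep_cong cong_refl)
    then show "[(torus_rep L (z + u + axis i (int t)) + axis i 1) $ l = (z + u + axis i (int (Suc t))) $ l] (mod int L)"
      by (auto simp: axis_def algebra_simps split: if_splits)
  qed
  have diff: "box_average L n z f - box_average L n (z + axis i (int s)) f
      = (\<Sum>x\<in>torus L. w x * (f x - f (T x)))" for f
  proof -
    have "f (torus_rep L (z + u)) - f (torus_rep L (z + axis i (int s) + u))
        = (\<Sum>t<s. f (pt (u, t)) - f (T (pt (u, t))))" for u
    proof -
      have ax: "axis i (0::int) = (0 :: int ^ 'd)" by (simp add: axis_def vec_eq_iff)
      have "(\<Sum>t<s. f (torus_rep L (z + u + axis i (int t))) - f (torus_rep L (z + u + axis i (int (Suc t)))))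
          = f (torus_rep L (z + u)) - f (torus_rep L (z + u + axis i (int s)))"
        by (subst sum_lessThan_telescope') (simp add: ax)
      then show ?thesis unfolding T_pt by (simp add: pt_def add_ac)
    qed
    note path = this
    have "box_average L n z f - box_average L n (z + axis i (int s)) f
        = (\<Sum>u\<in>int_box n. \<Sum>t<s. f (pt (u, t)) - f (T (pt (u, t)))) / N"
      unfolding path[symmetric] by (simp add: box_average_def N_def sum_subtractf diff_divide_distrib)
    also have "(\<Sum>u\<in>int_box n. \<Sum>t<s. f (pt (u, t)) - f (T (pt (u, t)))) = (\<Sum>b\<in>B. f (pt b) - f (T (pt b)))"
      unfolding B_def by (simp add: sum.cartesian_product)
    also have "\<dots> = (\<Sum>x\<in>torus L. \<Sum>b\<in>{b \<in> B. pt b = x}. f (pt b) - f (T (pt b)))"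
      by (rule sum.group[symmetric]) (use finB ptT in auto)
    also have "\<dots> = (\<Sum>x\<in>torus L. real (card {b \<in> B. pt b = x}) * (f x - f (T x)))"
      by (intro sum.cong refl) simp
    finally show ?thesis
      unfolding w_def by (simp add: sum_divide_distrib)
  qed
  have inj: "inj_on (\<lambda>x. (x, T x)) (torus L)" by (auto intro: inj_onI)
  have sub: "(\<lambda>x. (x, T x)) ` torus L \<subseteq> torus_pairs L"
    using torus_rep_in_torus[OF L] by (fastforce simp: torus_pairs_iff[OF L] T_def)
  have sum_pairs: "(\<Sum>p\<in>torus_pairs L. if snd p = T (fst p) then g (fst p) else 0) = (\<Sum>x\<in>torus L. g x)" for g :: "_ \<Rightarrow> real"
  proof -
    have "(\<Sum>p\<in>torus_pairs L. if snd p = T (fst p) then g (fst p) else 0)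
        = (\<Sum>p\<in>(\<lambda>x. (x, T x)) ` torus L. if snd p = T (fst p) then g (fst p) else 0)"
    proof (rule sum.mono_neutral_right)
      show "\<forall>p\<in>torus_pairs L - (\<lambda>x. (x, T x)) ` torus L. (if snd p = T (fst p) then g (fst p) else 0) = 0"
        using torus_pairs_subset[of L] by (auto simp: image_iff)
    qed (use sub in auto)
    also have "\<dots> = (\<Sum>x\<in>torus L. g x)"
      by (simp add: sum.reindex[OF inj])
    finally show ?thesis .
  qed
  have w_le: "w x \<le> real s / N" for x
  proof -
    \<comment> \<open>At a fixed time the paths occupy a translate of the box, which embeds in the
      torus because \<open>n \<le> L\<close>; hence a site is visited at most once per time step, at
      most \<open>s\<close> times in all.\<close>
    have "inj_on snd {b \<in> B. pt b = x}"
    proof (rule inj_onI)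
      fix b b' assume b: "b \<in> {b \<in> B. pt b = x}" "b' \<in> {b \<in> B. pt b = x}" "snd b = snd b'"
      obtain u t where ut: "b = (u, t)" by (cases b)
      obtain u' where ut': "b' = (u', t)" using b(3) ut by (cases b') auto
      have "u \<in> int_box n" "u' \<in> int_box n" and eq: "pt (u, t) = pt (u', t)"
        using b ut ut' by (auto simp: B_def)
      have "u $ l = u' $ l" for l
      proof -
        have "[(z + u + axis i (int t)) $ l = (z + u' + axis i (int t)) $ l] (mod int L)"
          using eq unfolding pt_def case_prod_conv by (metis cong_sym cong_trans torus_rep_cong)
        then have "int L dvd u $ l - u' $ l"
          by (simp add: cong_iff_dvd_diff algebra_simps)
        moreover have "\<bar>u $ l - u' $ l\<bar> < int L"
          using \<open>u \<in> int_box n\<close> \<open>u' \<in> int_box n\<close> n by (auto simp: int_box_def dest!: spec[of _ l])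
        ultimately show ?thesis
          using dvd_imp_le_int[of "u $ l - u' $ l" "int L"] by fastforce
      qed
      then show "b = b'" by (simp add: ut ut' vec_eq_iff)
    qed
    then have "card {b \<in> B. pt b = x} = card (snd ` {b \<in> B. pt b = x})"
      by (simp add: card_image)
    also have "\<dots> \<le> card {..<s}"
      by (intro card_mono) (auto simp: B_def)
    finally show ?thesis using N0 by (simp add: w_def divide_right_mono)
  qed
  have w0: "0 \<le> w x" for x using N0 by (simp add: w_def)
  have w_sum: "(\<Sum>x\<in>torus L. w x) = real s"
  proof -
    have "(\<Sum>x\<in>torus L. \<Sum>b\<in>{b \<in> B. pt b = x}. 1 :: real) = (\<Sum>b\<in>B. 1)"
      by (rule sum.group) (use finB ptT in auto)
    then have "(\<Sum>x\<in>torus L. real (card {b \<in> B. pt b = x})) = N * real s"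
      by (simp add: B_def card_int_box N_def)
    then show ?thesis using N0 by (simp add: w_def flip: sum_divide_distrib)
  qed
  have "(\<Sum>p\<in>torus_pairs L. (k p)\<^sup>2) = (\<Sum>x\<in>torus L. (w x)\<^sup>2)"
    unfolding sum_pairs[symmetric] by (intro sum.cong) (auto simp: k_def)
  also have "\<dots> \<le> (\<Sum>x\<in>torus L. real s / N * w x)"
    unfolding power2_eq_square by (intro sum_mono mult_right_mono w_le w0)
  also have "\<dots> = (real s)\<^sup>2 / N"
    unfolding sum_distrib_left[symmetric] w_sum by (simp add: power2_eq_square)
  \<comment> \<open>Dimension at least 3 makes the energy decay with the scale
    \<open>n\<close>.\<close>
  also have "\<dots> \<le> (real n)\<^sup>2 / real n ^ 3"
    unfolding N_def using s n d by (intro frac_le power_mono power_increasing) auto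
  also have "\<dots> = 1 / real n"
    using n by (simp add: power2_eq_square power3_eq_cube)
  finally have "L2_set k (torus_pairs L) \<le> sqrt (1 / real n)"
    unfolding L2_set_def by (rule real_sqrt_le_mono)
  moreover have "box_average L n z f - box_average L n (z + axis i (int s)) f
      = (\<Sum>p\<in>torus_pairs L. k p * (f (fst p) - f (snd p)))" for f
    unfolding diff sum_pairs[symmetric] by (intro sum.cong) (auto simp: k_def)
  ultimately show ?thesis
    unfolding has_flow_def by (auto simp: real_sqrt_divide)
qed

lemma has_flow_box_shift_axis:
  fixes z :: "int ^ 'd"
  assumes L: "L > 0" and n: "1 \<le> n" "n \<le> L" and c: "\<bar>c\<bar> \<le> int n" and d: "3 \<le> CARD('d)"
  shows "has_flow L (\<lambda>f. box_average L n z f - box_average L n (z + axis i c) f) (1 / sqrt (real n))"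
proof (cases "c \<ge> 0")
  case True
  then show ?thesis using has_flow_box_shift_pos[OF L n, of "nat c" z i] c d by simp
next
  case False
  have eq: "z + axis i c + axis i (- c) = z" by (simp add: axis_def vec_eq_iff)
  have "has_flow L (\<lambda>f. box_average L n (z + axis i c) f - box_average L n z f) (1 / sqrt (real n))"
    using has_flow_box_shift_pos[OF L n _ d, of "nat (- c)" "z + axis i c" i, unfolded eq] c False
    by (simp add: eq)
  then show ?thesis by (rule has_flow_swap)
qed

text \<open>The shift is made one coordinate at a time, \<open>S\<close> being the set of
  coordinates already moved; each of the \<open>d\<close> moves costs
  \<open>1 / sqrt n\<close>.\<close>

lemma has_flow_box_shift:
  fixes z v :: "int ^ 'd"
  assumes L: "L > 0" and n: "1 \<le> n" "n \<le> L" and v: "\<And>i. \<bar>v $ i\<bar> \<le> int n" and d: "3 \<le> CARD('d)"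
  shows "has_flow L (\<lambda>f. box_average L n z f - box_average L n (z + v) f) (real CARD('d) / sqrt (real n))"
proof -
  have "has_flow L (\<lambda>f. box_average L n z f - box_average L n (z + (\<chi> i. if i \<in> S then v $ i else 0)) f)
      (real (card S) / sqrt (real n))" for S :: "'d set"
  proof (induction S rule: finite_induct[OF finite])
    case 1
    have "(\<chi> i. if i \<in> {} then v $ i else 0) = 0" by (simp add: vec_eq_iff)
    then show ?case using has_flow_0[of 0 L] by simp
  next
    case (2 j S)
    have "z + (\<chi> i. if i \<in> insert j S then v $ i else 0) = z + (\<chi> i. if i \<in> S then v $ i else 0) + axis j (v $ j)"
      using 2 by (auto simp: vec_eq_iff axis_def)
    moreover have "real (card (insert j S)) / sqrt (real n) = real (card S) / sqrt (real n) + 1 / sqrt (real n)"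
      using 2 by (simp add: add_divide_distrib)
    ultimately show ?case
      using has_flow_trans[OF 2(3) has_flow_box_shift_axis[OF L n v[of j] d, of _ j]] by metis
  qed
  from this[of UNIV] show ?thesis by simp
qed

text \<open>Coordinatewise division with remainder by \<open>n\<close> cuts the box of side
  \<open>2 * n\<close> into \<open>2 ^ d\<close> translates of the box of side \<open>n\<close>,
  indexed by 0-1 vectors \<open>\<epsilon>\<close>.\<close>

lemma box_average_double:
  fixes z :: "int ^ 'd"
  assumes n: "1 \<le> n"
  shows "box_average L (2 * n) z f = (\<Sum>\<epsilon>\<in>int_box 2. box_average L n (z + (\<chi> i. int n * \<epsilon> $ i)) f) / 2 ^ CARD('d)"
proof -
  have "(\<Sum>u\<in>int_box (2 * n). f (torus_rep L (z + u)))
      = (\<Sum>(\<epsilon>, u)\<in>int_box 2 \<times> int_box n. f (torus_rep L (z + (\<chi> i. int n * \<epsilon> $ i) + u)))"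
  proof (rule sum.reindex_bij_witness[of _ "\<lambda>(\<epsilon>, u). (\<chi> i. int n * \<epsilon> $ i) + u" "\<lambda>u. (\<chi> i. u $ i div int n, \<chi> i. u $ i mod int n)"])
    fix u :: "int ^ 'd" assume u: "u \<in> int_box (2 * n)"
    show "(case (\<chi> i. u $ i div int n, \<chi> i. u $ i mod int n) of (\<epsilon>, u) \<Rightarrow> (\<chi> i. int n * \<epsilon> $ i) + u) = u"
      by (simp add: vec_eq_iff)
    have "u $ i div int n < 2" for i
    proof -
      have "u $ i < 2 * int n" using u by (auto simp: int_box_def)
      moreover have "int n * (u $ i div int n) \<le> u $ i"
        using mult_div_mod_eq[of "int n" "u $ i"] pos_mod_sign[of "int n" "u $ i"] n by linarith
      ultimately have "int n * (u $ i div int n) < int n * 2" by linarith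
      then show ?thesis using n by simp
    qed
    moreover have "0 \<le> u $ i div int n" for i
      using u n by (auto simp: int_box_def intro!: pos_imp_zdiv_nonneg_iff[THEN iffD2])
    ultimately show "(\<chi> i. u $ i div int n, \<chi> i. u $ i mod int n) \<in> int_box 2 \<times> (int_box n :: (int ^ 'd) set)"
      using n by (auto simp: int_box_def)
    show "(case (\<chi> i. u $ i div int n, \<chi> i. u $ i mod int n) of (\<epsilon>, u) \<Rightarrow>
        f (torus_rep L (z + (\<chi> i. int n * \<epsilon> $ i) + u))) = f (torus_rep L (z + u))"
    proof -
      have "z + (\<chi> i. int n * (u $ i div int n)) + (\<chi> i. u $ i mod int n) = z + u"
        by (simp add: vec_eq_iff)
      then show ?thesis by (simp only: case_prod_conv vec_lambda_beta)
    qed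
  next
    fix b :: "(int ^ 'd) \<times> (int ^ 'd)" assume b: "b \<in> int_box 2 \<times> int_box n"
    obtain \<epsilon> u where eu: "b = (\<epsilon>, u)" by (cases b)
    have e: "0 \<le> \<epsilon> $ i" "\<epsilon> $ i < 2" and u: "0 \<le> u $ i" "u $ i < int n" for i
      using b by (auto simp: eu int_box_def)
    show "(\<lambda>u. (\<chi> i. u $ i div int n, \<chi> i. u $ i mod int n)) (case b of (\<epsilon>, u) \<Rightarrow> (\<chi> i. int n * \<epsilon> $ i) + u) = b"
      using u n by (simp add: eu vec_eq_iff)
    have "int n * \<epsilon> $ i + u $ i < int (2 * n)" for i
    proof -
      have "int n * \<epsilon> $ i \<le> int n * 1" using e[of i] by (intro mult_left_mono) auto
      moreover have "u $ i < int n" by (rule u)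
      ultimately show ?thesis by linarith
    qed
    then show "(case b of (\<epsilon>, u) \<Rightarrow> (\<chi> i. int n * \<epsilon> $ i) + u) \<in> int_box (2 * n)"
      using e u by (auto simp: eu int_box_def)
  qed
  then show ?thesis
    unfolding box_average_def
    by (simp add: sum.cartesian_product[symmetric] power_mult_distrib sum_divide_distrib mult_ac)
qed

text \<open>The large box is an average of \<open>2 ^ d\<close> translates of the small one, each
  displaced by at most \<open>n\<close> in every coordinate. The average of the corresponding flows
  costs no more than a single shift.\<close>

lemma has_flow_box_double:
  fixes z :: "int ^ 'd"
  assumes L: "L > 0" and n: "1 \<le> n" "n \<le> L" and d: "3 \<le> CARD('d)"
  shows "has_flow L (\<lambda>f. box_average L n z f - box_average L (2 * n) z f) (real CARD('d) / sqrt (real n))"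
proof -
  let ?v = "\<lambda>\<epsilon>. (\<chi> i. int n * \<epsilon> $ i) :: int ^ 'd"
  have card2: "card (int_box 2 :: (int ^ 'd) set) = 2 ^ CARD('d)" by (simp add: card_int_box)
  have "has_flow L (\<lambda>f. \<Sum>\<epsilon>\<in>int_box 2. box_average L n z f - box_average L n (z + ?v \<epsilon>) f)
     (\<Sum>\<epsilon>\<in>(int_box 2 :: (int ^ 'd) set). real CARD('d) / sqrt (real n))"
  proof (intro has_flow_sum has_flow_box_shift L n d)
    fix \<epsilon> :: "int ^ 'd" and i assume "\<epsilon> \<in> int_box 2"
    then have "\<epsilon> $ i = 0 \<or> \<epsilon> $ i = 1" by (auto simp: int_box_def dest!: spec[of _ i])
    then show "\<bar>?v \<epsilon> $ i\<bar> \<le> int n" by auto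
  qed auto
  from has_flow_scale[OF this, of "1 / 2 ^ CARD('d)"] show ?thesis
    by (simp add: box_average_double[OF n(1)] sum_subtractf card2 right_diff_distrib diff_divide_distrib)
qed

text \<open>A box of side 1 is a single point, and doubling at side \<open>2 ^ j\<close> costs
  \<open>d * q ^ j\<close> with \<open>q = 1 / sqrt 2\<close>; the geometric series is bounded
  independently of \<open>J\<close>.\<close>

lemma has_flow_to_box:
  fixes z :: "int ^ 'd"
  assumes L: "L > 0" and J: "2 ^ J \<le> L" and d: "3 \<le> CARD('d)"
  shows "has_flow L (\<lambda>f. f (torus_rep L z) - box_average L (2 ^ J) z f) (4 * real CARD('d))"
proof -
  define q where "q = 1 / sqrt 2"
  \<comment> \<open>The rational bound \<open>q \<le> 3 / 4\<close> turns the sum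
    \<open>1 / (1 - q)\<close> into the clean constant 4.\<close>
  have "4 / 3 \<le> sqrt 2" by (rule real_le_rsqrt) (simp add: power2_eq_square)
  then have "1 / sqrt 2 \<le> 1 / (4 / 3)" by (intro frac_le) auto
  then have q: "0 \<le> q" "q \<le> 3 / 4" by (simp_all add: q_def)
  have "has_flow L (\<lambda>f. f (torus_rep L z) - box_average L (2 ^ j) z f) (\<Sum>i<j. real CARD('d) * q ^ i)"
    if "2 ^ j \<le> L" for j
    using that
  proof (induction j)
    case 0
    have "0 \<le> a \<and> a < 1 \<longleftrightarrow> a = 0" for a :: int by auto
    then have "(int_box 1 :: (int ^ 'd) set) = {0}"
      by (simp add: int_box_def set_eq_iff vec_eq_iff)
    then show ?case using has_flow_0[of 0 L] by (simp add: box_average_def)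
  next
    case (Suc j)
    then have le: "2 ^ j \<le> L" by simp
    have "has_flow L (\<lambda>f. f (torus_rep L z) - box_average L (2 * 2 ^ j) z f)
        ((\<Sum>i<j. real CARD('d) * q ^ i) + real CARD('d) / sqrt (real (2 ^ j)))"
      by (rule has_flow_trans[OF Suc.IH[OF le] has_flow_box_double[OF L _ le d]]) simp
    moreover have "real CARD('d) / sqrt (real (2 ^ j)) = real CARD('d) * q ^ j"
      by (simp add: q_def real_sqrt_power power_one_over)
    ultimately show ?case by simp
  qed
  moreover have "(\<Sum>i<J. real CARD('d) * q ^ i) \<le> 4 * real CARD('d)"
  proof -
    have "(\<Sum>i<J. q ^ i) = (1 - q ^ J) / (1 - q)"
      using q by (simp add: sum_gp_strict)
    also have "\<dots> \<le> 1 / (1 / 4)"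
      using q by (intro frac_le) auto
    finally show ?thesis
      by (simp add: mult_left_mono mult.commute flip: sum_distrib_left)
  qed
  ultimately show ?thesis using J has_flow_mono by blast
qed

text \<open>\<open>2 ^ J\<close> is the largest power of two not exceeding \<open>L\<close>, so it
  is more than \<open>L / 2\<close>. The displacement from \<open>x\<close> to \<open>y\<close>,
  reduced modulo \<open>L\<close>, has coordinates of size at most \<open>L / 2\<close>, and one
  shift of the box at scale \<open>2 ^ J\<close> covers it. The cost is \<open>4 * d\<close> to
  spread, at most \<open>d\<close> to shift and \<open>4 * d\<close> to contract.\<close>

theorem has_flow_between:
  fixes x y :: "int ^ 'd"
  assumes L: "L > 0" and x: "x \<in> torus L" and y: "y \<in> torus L" and d: "3 \<le> CARD('d)"
  shows "has_flow L (\<lambda>f. f x - f y) (9 * real CARD('d))"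
proof -
  obtain J where J: "2 ^ J \<le> L" "L < 2 ^ (J + 1)"
    using ex_power_ivl1[of 2 L] L by auto
  define v where "v = torus_rep L (y - x)"
  have rep: "torus_rep L (x + v) = y"
    unfolding torus_rep_eq_iff[OF L]
  proof (intro conjI y allI)
    fix i
    have "[x $ i + v $ i = x $ i + (y - x) $ i] (mod int L)"
      unfolding v_def by (intro cong_add torus_rep_cong cong_refl)
    then show "[y $ i = (x + v) $ i] (mod int L)" by (simp add: cong_sym)
  qed
  have v: "\<bar>v $ i\<bar> \<le> int (2 ^ J)" for i
  proof -
    have "\<bar>real_of_int (v $ i)\<bar> \<le> real L / 2"
      using torus_rep_in_torus[OF L, of "y - x"] by (auto simp: torus_def v_def dest!: spec[of _ i])
    also have "\<dots> \<le> real (2 ^ J)"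
      using J(2) by (simp add: field_simps flip: of_nat_less_iff[where 'a=real])
    finally show ?thesis by linarith
  qed
  have "has_flow L (\<lambda>f. f (torus_rep L x) - f (torus_rep L (x + v)))
     ((4 * real CARD('d) + real CARD('d) / sqrt (real (2 ^ J))) + 4 * real CARD('d))"
    by (rule has_flow_trans[OF has_flow_trans[OF has_flow_to_box has_flow_box_shift] has_flow_swap[OF has_flow_to_box]])
      (use L J v d in auto)
  note flow = this[unfolded rep torus_rep_id[OF L x]]
  have "real CARD('d) / sqrt (real (2 ^ J)) \<le> real CARD('d) / 1"
    by (intro frac_le) auto
  then show ?thesis
    by (intro has_flow_mono[OF flow]) simp
qed

section \<open>Rotation invariance of the uniform measure on the sphere\<close>

lemma borel_measurable_orthogonal:
  fixes R :: "'a::euclidean_space \<Rightarrow> 'a"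
  assumes "orthogonal_transformation R"
  shows "R \<in> borel_measurable borel"
  using orthogonal_transformation_linear[OF assms]
  by (intro borel_measurable_continuous_onI linear_continuous_on linear_conv_bounded_linear[THEN iffD1])

text \<open>Both sides of \<open>\<mu> B * \<integral> g d\<lambda> = \<lambda> B * \<integral> g d\<mu>\<close>, for translation invariant measures and the
  unit ball \<open>B\<close>, compute the integral of \<open>indicator B x * g (x + y)\<close> over \<open>\<mu> \<otimes> \<lambda>\<close>; here \<open>\<lambda>\<close> is
  Lebesgue measure and \<open>\<mu>\<close> its image under an orthogonal transformation, which preserves \<open>B\<close>.\<close>

lemma distr_lborel_orthogonal:
  fixes R :: "'a::euclidean_space \<Rightarrow> 'a"
  assumes R: "orthogonal_transformation R"
  shows "distr lborel borel R = lborel"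
proof -
  define \<mu> where "\<mu> = distr lborel borel R"
  have lin: "linear R" using R by (rule orthogonal_transformation_linear)
  note [measurable] = borel_measurable_orthogonal[OF R]
  have [measurable_cong]: "sets \<mu> = sets borel" by (simp add: \<mu>_def)
  have nR: "norm (R x) = norm x" for x
    using R by (simp add: orthogonal_transformation)
  have vimage_ball: "R -` ball 0 r = ball 0 r" for r
    by (auto simp: nR)
  define v where "v = emeasure lborel (ball (0::'a) 1)"
  have v: "v \<noteq> 0" "v < \<infinity>"
    using content_ball_pos[of 1 "0::'a"] emeasure_lborel_ball_finite[of "0::'a" 1]
    unfolding v_def by (auto simp: measure_def)
  have mu_ball: "emeasure \<mu> (ball 0 r) = emeasure lborel (ball (0::'a) r)" for r
    unfolding \<mu>_def by (subst emeasure_distr) (auto simp: vimage_ball)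
  have "sigma_finite_measure \<mu>"
  proof (rule sigma_finite_measure.intro, intro exI conjI)
    show "countable (range (\<lambda>n::nat. ball (0::'a) (real n)))" by simp
    show "range (\<lambda>n::nat. ball (0::'a) (real n)) \<subseteq> sets \<mu>" by auto
    show "\<Union> (range (\<lambda>n::nat. ball (0::'a) (real n))) = space \<mu>"
      using reals_Archimedean2 by (auto simp: \<mu>_def)
    show "\<forall>a\<in>range (\<lambda>n::nat. ball (0::'a) (real n)). emeasure \<mu> a \<noteq> \<infinity>"
      using emeasure_lborel_ball_finite[of "0::'a"] by (auto simp: mu_ball less_top)
  qed
  then interpret \<mu>: sigma_finite_measure \<mu> .
  interpret P: pair_sigma_finite \<mu> "lborel :: 'a measure" ..
  have shift_l: "(\<integral>\<^sup>+y. g (x + y) \<partial>lborel) = (\<integral>\<^sup>+y. g y \<partial>lborel)"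
    if [measurable]: "g \<in> borel_measurable borel" for g :: "'a \<Rightarrow> ennreal" and x
    by (subst (2) lborel_distr_plus[of x, symmetric]) (simp add: nn_integral_distr)
  have shift_m: "(\<integral>\<^sup>+x. g (x + t) \<partial>\<mu>) = (\<integral>\<^sup>+x. g x \<partial>\<mu>)"
    if [measurable]: "g \<in> borel_measurable borel" for g :: "'a \<Rightarrow> ennreal" and t
  proof -
    \<comment> \<open>\<open>R\<close> is onto, so translating the image measure by \<open>t\<close>
      amounts to translating Lebesgue measure by a preimage \<open>s\<close>.\<close>
    obtain s where s: "t = R s"
      using orthogonal_transformation_surj[OF R] by (metis surjD)
    have "(\<integral>\<^sup>+x. g (x + t) \<partial>\<mu>) = (\<integral>\<^sup>+x. g (R (s + x)) \<partial>lborel)"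
      unfolding \<mu>_def by (subst nn_integral_distr) (auto simp: s linear_add[OF lin] add.commute)
    also have "\<dots> = (\<integral>\<^sup>+x. g (R x) \<partial>lborel)"
      by (rule shift_l[of "\<lambda>x. g (R x)"]) measurable
    also have "\<dots> = (\<integral>\<^sup>+x. g x \<partial>\<mu>)"
      unfolding \<mu>_def by (subst nn_integral_distr) auto
    finally show ?thesis .
  qed
  define B :: "'a \<Rightarrow> ennreal" where "B = indicator (ball 0 1)"
  have [measurable]: "B \<in> borel_measurable borel"
    unfolding B_def by (rule borel_measurable_indicator) simp
  have intB: "(\<integral>\<^sup>+y. B y \<partial>lborel) = v"
    by (simp add: B_def v_def)
  have main: "(\<integral>\<^sup>+x. g x \<partial>\<mu>) = (\<integral>\<^sup>+x. g x \<partial>lborel)"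
    if [measurable]: "g \<in> borel_measurable borel" for g :: "'a \<Rightarrow> ennreal"
  proof -
    have "v * (\<integral>\<^sup>+x. g x \<partial>lborel) = (\<integral>\<^sup>+x. B x * (\<integral>\<^sup>+y. g (x + y) \<partial>lborel) \<partial>\<mu>)"
    proof -
      have "B \<in> borel_measurable \<mu>" by measurable
      then show ?thesis
        unfolding shift_l[OF that] by (subst nn_integral_multc) (auto simp: mu_ball v_def B_def)
    qed
    also have "\<dots> = (\<integral>\<^sup>+x. \<integral>\<^sup>+y. B x * g (x + y) \<partial>lborel \<partial>\<mu>)"
      by (intro nn_integral_cong nn_integral_cmult[symmetric]) measurable
    also have "\<dots> = (\<integral>\<^sup>+y. \<integral>\<^sup>+x. B x * g (x + y) \<partial>\<mu> \<partial>lborel)"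
      by (rule P.Fubini'[symmetric]) measurable
    also have "\<dots> = (\<integral>\<^sup>+y. \<integral>\<^sup>+x. B (x - y) * g x \<partial>\<mu> \<partial>lborel)"
    proof (rule nn_integral_cong)
      fix y :: 'a
      show "(\<integral>\<^sup>+x. B x * g (x + y) \<partial>\<mu>) = (\<integral>\<^sup>+x. B (x - y) * g x \<partial>\<mu>)"
        using shift_m[of "\<lambda>x. B (x - y) * g x" y] by simp
    qed
    also have "\<dots> = (\<integral>\<^sup>+x. \<integral>\<^sup>+y. B (x - y) * g x \<partial>lborel \<partial>\<mu>)"
      by (rule P.Fubini') measurable
    also have "\<dots> = (\<integral>\<^sup>+x. v * g x \<partial>\<mu>)"
    proof (rule nn_integral_cong)
      fix x :: 'a
      have "(\<integral>\<^sup>+y. B (x - y) * g x \<partial>lborel) = (\<integral>\<^sup>+y. B (- x + y) * g x \<partial>lborel)"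
        by (intro nn_integral_cong arg_cong2[of _ _ _ _ "(*)"])
          (auto simp: B_def indicator_def norm_minus_commute)
      also have "\<dots> = (\<integral>\<^sup>+y. B y * g x \<partial>lborel)"
        by (rule shift_l[of "\<lambda>y. B y * g x"]) measurable
      also have "\<dots> = v * g x" by (simp add: nn_integral_multc intB)
      finally show "(\<integral>\<^sup>+y. B (x - y) * g x \<partial>lborel) = v * g x" .
    qed
    also have "\<dots> = v * (\<integral>\<^sup>+x. g x \<partial>\<mu>)"
      by (rule nn_integral_cmult) measurable
    finally show ?thesis
      using v by (auto simp: ennreal_mult_cancel_left)
  qed
  show ?thesis
  proof (rule measure_eqI)
    fix A assume "A \<in> sets (distr lborel borel R)"
    then have "A \<in> sets borel" by simp
    then show "emeasure (distr lborel borel R) A = emeasure lborel A"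
      using main[of "indicator A"] unfolding \<mu>_def by simp
  qed simp
qed

text \<open>\<open>R\<close> preserves Lebesgue measure and the unit ball, hence the uniform law on
  the ball, and it commutes with the radial projection \<open>sgn\<close>.\<close>

lemma distr_sphere_uniform_orthogonal:
  fixes R :: "real ^ 'n \<Rightarrow> real ^ 'n"
  assumes R: "orthogonal_transformation R"
  shows "distr sphere_uniform borel R = sphere_uniform"
proof -
  let ?U = "uniform_measure lborel (ball (0 :: real ^ 'n) 1)"
  note [measurable] = borel_measurable_orthogonal[OF R]
  have lin: "linear R" using R by (rule orthogonal_transformation_linear)
  have nR: "norm (R x) = norm x" for x
    using R by (simp add: orthogonal_transformation)
  have U: "distr ?U borel R = ?U"
  proof (rule measure_eqI)
    fix A assume "A \<in> sets (distr ?U borel R)"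
    then have A: "A \<in> sets borel" by simp
    then have RA: "R -` A \<in> sets borel"
      using measurable_sets[OF borel_measurable_orthogonal[OF R] A] by simp
    have "emeasure (distr ?U borel R) A = emeasure lborel (ball 0 1 \<inter> R -` A) / emeasure lborel (ball (0 :: real ^ 'n) 1)"
      using A RA by (subst emeasure_distr) auto
    also have "ball 0 1 \<inter> R -` A = R -` (ball 0 1 \<inter> A) \<inter> space lborel"
      by (auto simp: nR)
    also have "emeasure lborel (R -` (ball 0 1 \<inter> A) \<inter> space lborel) = emeasure (distr lborel borel R) (ball 0 1 \<inter> A)"
      using A by (subst emeasure_distr) auto
    also have "\<dots> = emeasure lborel (ball 0 1 \<inter> A)"
      by (simp add: distr_lborel_orthogonal[OF R])
    finally show "emeasure (distr ?U borel R) A = emeasure ?U A"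
      using A by simp
  qed simp
  have sgn_R: "R (sgn x) = sgn (R x)" for x
    by (simp add: sgn_div_norm nR linear_scale[OF lin])
  have "distr sphere_uniform borel R = distr ?U borel (\<lambda>x. R (sgn x))"
    unfolding sphere_uniform_def by (subst distr_distr) (auto simp: comp_def)
  also have "\<dots> = distr (distr ?U borel R) borel sgn"
    unfolding sgn_R by (subst distr_distr) (auto simp: comp_def)
  finally show ?thesis
    unfolding U sphere_uniform_def .
qed

text \<open>For distinct \<open>a\<close> and \<open>b\<close>, the rotation by 45 degrees in their
  coordinate plane. Its use is that the product of the two new coordinates is half the difference of
  the squares of the old ones.\<close>

definition plane_rotation :: "'n \<Rightarrow> 'n \<Rightarrow> real ^ 'n \<Rightarrow> real ^ 'n" where
  "plane_rotation a b x = (\<chi> i. if i = a then (x $ a - x $ b) / sqrt 2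
     else if i = b then (x $ a + x $ b) / sqrt 2 else x $ i)"

lemma orthogonal_plane_rotation:
  assumes "a \<noteq> b"
  shows "orthogonal_transformation (plane_rotation a b)"
  unfolding orthogonal_transformation
proof (intro conjI allI)
  show "linear (plane_rotation a b)"
    by (rule linearI) (auto simp: plane_rotation_def vec_eq_iff add_divide_distrib diff_divide_distrib algebra_simps)
  fix x
  have split: "(\<Sum>i\<in>UNIV. f i) = f a + f b + (\<Sum>i\<in>UNIV - {a, b}. f i)" for f :: "'a \<Rightarrow> real"
    using assms by (subst sum.subset_diff[of "{a, b}"]) (auto simp: add.commute)
  have "((x $ a - x $ b) / sqrt 2)\<^sup>2 + ((x $ a + x $ b) / sqrt 2)\<^sup>2 = (x $ a)\<^sup>2 + (x $ b)\<^sup>2"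
    by (simp add: power_divide power2_eq_square field_simps)
  then have "(\<Sum>i\<in>UNIV. (plane_rotation a b x $ i)\<^sup>2) = (\<Sum>i\<in>UNIV. (x $ i)\<^sup>2)"
    unfolding split using assms by (simp add: plane_rotation_def)
  then show "norm (plane_rotation a b x) = norm x"
    by (simp add: norm_vec_def L2_set_def)
qed

lemma orthogonal_coordinate_swap:
  "orthogonal_transformation (\<lambda>x :: real ^ 'n. \<chi> i. x $ Transposition.transpose a b i)"
  unfolding orthogonal_transformation
proof (intro conjI allI)
  show "linear (\<lambda>x :: real ^ 'n. \<chi> i. x $ Transposition.transpose a b i)"
    by (rule linearI) (auto simp: vec_eq_iff)
  fix x :: "real ^ 'n"
  have "(\<Sum>i\<in>UNIV. (x $ Transposition.transpose a b i)\<^sup>2) = (\<Sum>i\<in>UNIV. (x $ i)\<^sup>2)"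
    by (rule sum.reindex_bij_witness[of _ "Transposition.transpose a b" "Transposition.transpose a b"]) auto
  then show "norm (\<chi> i. x $ Transposition.transpose a b i) = norm x"
    by (simp add: norm_vec_def L2_set_def)
qed

section \<open>The spin model\<close>

text \<open>The factor 4 combines two halves: \<open>hamiltonian\<close> takes half the sum over
  ordered pairs, and on unit spins \<open>u \<bullet> v\<close> is
  \<open>1 - (norm (u - v))\<^sup>2 / 2\<close>.\<close>

definition gibbs_weight :: "nat \<Rightarrow> real \<Rightarrow> (int ^ 'd \<Rightarrow> real ^ 'n) \<Rightarrow> real" where
  "gibbs_weight L \<beta> \<phi> = exp (- (\<beta> / 4) * bond_energy (torus_pairs L) fst snd (\<lambda>_. 0) \<phi> \<phi>)"

lemma torus_pairsD:
  assumes "p \<in> torus_pairs L"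
  shows "fst p \<in> torus L" "snd p \<in> torus L"
  using assms torus_pairs_subset[of L] by auto

abbreviation spin_measure :: "nat \<Rightarrow> (int ^ 'd \<Rightarrow> real ^ 'n) measure" where
  "spin_measure L \<equiv> Pi\<^sub>M (torus L) (\<lambda>_. sphere_uniform)"

lemma sets_sphere_uniform [measurable_cong]: "sets sphere_uniform = sets borel"
  by (simp add: sphere_uniform_def)

lemma single_spin_sphere: "\<gamma> > 0 \<Longrightarrow> single_spin \<gamma> (sphere_uniform :: (real ^ 'n) measure)"
  by (intro single_spin.intro prob_space_sphere_uniform sets_sphere_uniform)

lemma prob_space_spin_measure: "prob_space (spin_measure L :: (int ^ 'd \<Rightarrow> real ^ 'n) measure)"
  by (intro prob_space_PiM prob_space_sphere_uniform)

lemma AE_spin_measure: "AE \<phi> in (spin_measure L :: (int ^ 'd \<Rightarrow> real ^ 'n) measure). \<forall>x\<in>torus L. norm (\<phi> x) = 1"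
proof (intro AE_finite_allI)
  fix x :: "int ^ 'd" assume "x \<in> torus L"
  then have "AE \<phi> in (spin_measure L :: (int ^ 'd \<Rightarrow> real ^ 'n) measure). \<phi> x \<in> sphere 0 1"
    by (intro AE_PiM_component prob_space_sphere_uniform AE_sphere_uniform)
  then show "AE \<phi> in (spin_measure L :: (int ^ 'd \<Rightarrow> real ^ 'n) measure). norm (\<phi> x) = 1"
    by simp
qed simp

lemma measurable_spin_torus:
  "x \<in> torus L \<Longrightarrow> (\<lambda>\<phi>. \<phi> x) \<in> borel_measurable (spin_measure L :: (int ^ 'd \<Rightarrow> real ^ 'n) measure)"
  by (rule single_spin.measurable_spin[OF single_spin_sphere[of 1]]) auto

lemma measurable_gibbs_weight [measurable]:
  "gibbs_weight L \<beta> \<in> borel_measurable (spin_measure L :: (int ^ 'd \<Rightarrow> real ^ 'n) measure)"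
  using single_spin.measurable_bond_energy[OF single_spin_sphere[of 1] torus_pairs_subset[of L], of "\<lambda>_. 0"]
  unfolding gibbs_weight_def by measurable

lemma gibbs_weight_bounds:
  assumes "\<beta> > 0"
  shows "0 < gibbs_weight L \<beta> \<phi>" "gibbs_weight L \<beta> \<phi> \<le> 1"
  using assms by (auto simp: gibbs_weight_def intro!: mult_nonneg_nonneg bond_energy_nonneg)

lemma integrable_gibbs:
  fixes f :: "(int ^ 'd \<Rightarrow> real ^ 'n) \<Rightarrow> real"
  assumes \<beta>: "\<beta> > 0" and [measurable]: "f \<in> borel_measurable (spin_measure L)"
    and bound: "\<And>\<phi>. \<forall>x\<in>torus L. norm (\<phi> x) = 1 \<Longrightarrow> \<bar>f \<phi>\<bar> \<le> B"
  shows "integrable (spin_measure L) (\<lambda>\<phi>. f \<phi> * gibbs_weight L \<beta> \<phi>)"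
proof -
  interpret M: prob_space "spin_measure L :: (int ^ 'd \<Rightarrow> real ^ 'n) measure"
    by (rule prob_space_spin_measure)
  show ?thesis
  proof (rule M.integrable_const_bound[of _ B])
    show "AE \<phi> in spin_measure L. norm (f \<phi> * gibbs_weight L \<beta> \<phi>) \<le> B"
      using AE_spin_measure
    proof eventually_elim
      case (elim \<phi>)
      then have f: "\<bar>f \<phi>\<bar> \<le> B" by (rule bound)
      have "\<bar>f \<phi>\<bar> * gibbs_weight L \<beta> \<phi> \<le> B * 1"
        using f gibbs_weight_bounds[OF \<beta>, of L \<phi>] by (intro mult_mono) auto
      then show ?case
        using gibbs_weight_bounds[OF \<beta>, of L \<phi>] by (simp add: abs_mult)
    qed
  qed measurable
qed

lemma spin_expectation_eq_gibbs:
  fixes f :: "(int ^ 'd \<Rightarrow> real ^ 'n) \<Rightarrow> real"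
  assumes [measurable]: "f \<in> borel_measurable (spin_measure L)"
  shows "spin_expectation L \<beta> f =
    (\<integral>\<phi>. f \<phi> * gibbs_weight L \<beta> \<phi> \<partial>spin_measure L) / (\<integral>\<phi>. gibbs_weight L \<beta> \<phi> \<partial>(spin_measure L :: (int ^ 'd \<Rightarrow> real ^ 'n) measure))"
proof -
  let ?M = "spin_measure L :: (int ^ 'd \<Rightarrow> real ^ 'n) measure"
  let ?P = "torus_pairs L :: ((int ^ 'd) \<times> (int ^ 'd)) set"
  \<comment> \<open>Each ordered pair contributes the constant 2 to the energy, and
    \<open>(\<beta> / 4) * 2 = \<beta> / 2\<close>; the factor cancels between numerator and
    denominator.\<close>
  define C where "C = exp (\<beta> * real (card ?P) / 2)"
  have ham: "hamiltonian L \<phi> = - (\<Sum>p\<in>?P. \<phi> (fst p) \<bullet> \<phi> (snd p)) / 2" for \<phi> :: "int ^ 'd \<Rightarrow> real ^ 'n"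
    by (simp add: hamiltonian_def torus_pairs_def case_prod_unfold)
  have [measurable]: "hamiltonian L \<in> borel_measurable ?M"
    unfolding ham
  proof (intro borel_measurable_divide borel_measurable_uminus borel_measurable_sum borel_measurable_const)
    fix p assume "p \<in> ?P"
    then have "fst p \<in> torus L" "snd p \<in> torus L" by (rule torus_pairsD)+
    note [measurable] = this[THEN measurable_spin_torus]
    show "(\<lambda>\<phi>. \<phi> (fst p) \<bullet> \<phi> (snd p)) \<in> borel_measurable ?M" by measurable
  qed
  have AE: "AE \<phi> in ?M. exp (- \<beta> * hamiltonian L \<phi>) = C * gibbs_weight L \<beta> \<phi>"
    using AE_spin_measure
  proof eventually_elim
    case (elim \<phi>)
    have "bond_energy ?P fst snd (\<lambda>_. 0) \<phi> \<phi> = (\<Sum>p\<in>?P. 2 - 2 * (\<phi> (fst p) \<bullet> \<phi> (snd p)))"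
      unfolding bond_energy_def
    proof (intro sum.cong refl)
      fix p assume "p \<in> ?P"
      then have "fst p \<in> torus L" "snd p \<in> torus L" by (rule torus_pairsD)+
      then have "\<phi> (fst p) \<bullet> \<phi> (fst p) = 1" "\<phi> (snd p) \<bullet> \<phi> (snd p) = 1"
        using elim by (simp_all add: norm_eq_1)
      then show "(norm (\<phi> (fst p) - \<phi> (snd p) - 0))\<^sup>2 = 2 - 2 * (\<phi> (fst p) \<bullet> \<phi> (snd p))"
        unfolding power2_norm_eq_inner by (simp add: inner_diff_left inner_diff_right inner_commute)
    qed
    also have "\<dots> = 2 * real (card ?P) - 2 * (\<Sum>p\<in>?P. \<phi> (fst p) \<bullet> \<phi> (snd p))"
      by (simp add: sum_subtractf sum_distrib_left)
    finally have be: "bond_energy ?P fst snd (\<lambda>_. 0) \<phi> \<phi> = 2 * real (card ?P) - 2 * (\<Sum>p\<in>?P. \<phi> (fst p) \<bullet> \<phi> (snd p))" .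
    have "- \<beta> * hamiltonian L \<phi> = \<beta> * real (card ?P) / 2 + - (\<beta> / 4) * bond_energy ?P fst snd (\<lambda>_. 0) \<phi> \<phi>"
      unfolding be ham by (simp add: field_simps)
    then show ?case
      unfolding gibbs_weight_def C_def exp_add[symmetric] by simp
  qed
  have "(\<integral>\<phi>. g \<phi> * exp (- \<beta> * hamiltonian L \<phi>) \<partial>?M) = C * (\<integral>\<phi>. g \<phi> * gibbs_weight L \<beta> \<phi> \<partial>?M)"
    if [measurable]: "g \<in> borel_measurable ?M" for g
  proof -
    have "(\<integral>\<phi>. g \<phi> * exp (- \<beta> * hamiltonian L \<phi>) \<partial>?M) = (\<integral>\<phi>. C * (g \<phi> * gibbs_weight L \<beta> \<phi>) \<partial>?M)"
      by (rule integral_cong_AE) (use AE in \<open>auto elim: eventually_mono\<close>)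
    then show ?thesis by simp
  qed
  from this[of f] this[of "\<lambda>_. 1"] show ?thesis
    unfolding spin_expectation_def by (simp add: C_def)
qed

text \<open>Applying \<open>R\<close> to all spins at once preserves the product measure, and it
  preserves every difference norm in the energy.\<close>

lemma gibbs_rotation_invariant:
  fixes R :: "real ^ 'n \<Rightarrow> real ^ 'n" and x :: "int ^ 'd"
  assumes R: "orthogonal_transformation R" and x: "x \<in> torus L"
    and g [measurable]: "g \<in> borel_measurable borel"
  shows "(\<integral>\<phi>. g (R (\<phi> x)) * gibbs_weight L \<beta> \<phi> \<partial>spin_measure L) = (\<integral>\<phi>. (g (\<phi> x) * gibbs_weight L \<beta> \<phi> :: real) \<partial>spin_measure L)"
proof -
  let ?M = "spin_measure L :: (int ^ 'd \<Rightarrow> real ^ 'n) measure"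
  note [measurable] = borel_measurable_orthogonal[OF R] measurable_spin_torus[OF x]
  have R_meas: "R \<in> sphere_uniform \<rightarrow>\<^sub>M sphere_uniform" by measurable
  have "distr sphere_uniform sphere_uniform R = distr sphere_uniform borel R"
    by (intro distr_cong) (simp_all add: sets_sphere_uniform)
  then have "distr ?M ?M (compose (torus L) R) = ?M"
    using distr_PiM_finite_prob_space'[of "torus L" "\<lambda>_. sphere_uniform" "\<lambda>_. sphere_uniform" R] R_meas
    by (simp add: prob_space_sphere_uniform distr_sphere_uniform_orthogonal[OF R])
  then have "(\<integral>\<phi>. g (\<phi> x) * gibbs_weight L \<beta> \<phi> \<partial>?M) = (\<integral>\<phi>. g (\<phi> x) * gibbs_weight L \<beta> \<phi> \<partial>distr ?M ?M (compose (torus L) R))"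
    by simp
  also have "\<dots> = (\<integral>\<phi>. g (compose (torus L) R \<phi> x) * gibbs_weight L \<beta> (compose (torus L) R \<phi>) \<partial>?M)"
  proof (rule integral_distr)
    show "compose (torus L) R \<in> ?M \<rightarrow>\<^sub>M ?M"
      unfolding compose_def
      by (intro measurable_restrict measurable_compose[OF measurable_component_singleton], assumption, rule R_meas)
  qed measurable
  also have "\<dots> = (\<integral>\<phi>. g (R (\<phi> x)) * gibbs_weight L \<beta> \<phi> \<partial>?M)"
  proof -
    have "bond_energy (torus_pairs L) fst snd (\<lambda>_. 0) (compose (torus L) R \<phi>) (compose (torus L) R \<phi>)
        = bond_energy (torus_pairs L) fst snd (\<lambda>_. 0) \<phi> \<phi>" for \<phi> :: "int ^ 'd \<Rightarrow> real ^ 'n"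
      unfolding bond_energy_def
    proof (intro sum.cong refl)
      fix p :: "(int ^ 'd) \<times> (int ^ 'd)" assume "p \<in> torus_pairs L"
      then have "fst p \<in> torus L" "snd p \<in> torus L" by (rule torus_pairsD)+
      moreover have "norm (R u - R v) = norm (u - v)" for u v
        using R by (metis linear_diff orthogonal_transformation orthogonal_transformation_linear)
      ultimately show "(norm (compose (torus L) R \<phi> (fst p) - compose (torus L) R \<phi> (snd p) - 0))\<^sup>2
          = (norm (\<phi> (fst p) - \<phi> (snd p) - 0))\<^sup>2"
        by (simp add: compose_def)
    qed
    then show ?thesis using x by (simp add: gibbs_weight_def compose_def)
  qed
  finally show ?thesis by simp
qed

text \<open>Rotating by 45 degrees and averaging gives \<open>E (p\<^sup>2 q\<^sup>2) = E (p\<^sup>4) / 3\<close> for the coordinates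
  \<open>p = \<phi> x $ a\<close> and \<open>q = \<phi> x $ b\<close>; and \<open>E (p\<^sup>4) \<ge> (E (p\<^sup>2))\<^sup>2 = 1 / N\<^sup>2\<close> since all
  coordinates have the same law and their squares sum to \<open>1\<close>.\<close>

lemma gibbs_square_lower_bound:
  fixes x :: "int ^ 'd" and a b :: "'n :: finite"
  assumes \<beta>: "\<beta> > 0" and x: "x \<in> torus L" and ab: "a \<noteq> b"
  shows "(\<integral>\<phi>. gibbs_weight L \<beta> \<phi> \<partial>(spin_measure L :: (int ^ 'd \<Rightarrow> real ^ 'n) measure)) / (3 * (real CARD('n))\<^sup>2)
    \<le> (\<integral>\<phi>. (\<phi> x $ a * \<phi> x $ b)\<^sup>2 * gibbs_weight L \<beta> \<phi> \<partial>spin_measure L)"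
proof -
  let ?M = "spin_measure L :: (int ^ 'd \<Rightarrow> real ^ 'n) measure"
  define N where "N = real CARD('n)"
  define E where "E g = (\<integral>\<phi>. g (\<phi> x) * gibbs_weight L \<beta> \<phi> \<partial>?M)" for g :: "real ^ 'n \<Rightarrow> real"
  have comp [measurable]: "(\<lambda>v :: real ^ 'n. v $ i) \<in> borel_measurable borel" for i
    by (rule borel_measurable_nth)
  have int: "integrable ?M (\<lambda>\<phi>. g (\<phi> x) * gibbs_weight L \<beta> \<phi>)"
    if [measurable]: "g \<in> borel_measurable borel" and B: "\<And>v. norm v = 1 \<Longrightarrow> \<bar>g v\<bar> \<le> 1" for g
  proof (rule integrable_gibbs[OF \<beta>, of _ _ 1])
    show "(\<lambda>\<phi>. g (\<phi> x)) \<in> borel_measurable ?M"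
      using measurable_spin_torus[OF x] by measurable
  qed (use B x in auto)
  have c1: "\<bar>v $ i\<bar> \<le> 1" if "norm v = 1" for v :: "real ^ 'n" and i
    using component_le_norm_cart[of v i] that by simp
  have int22: "integrable ?M (\<lambda>\<phi>. (\<phi> x $ i)\<^sup>2 * (\<phi> x $ j)\<^sup>2 * gibbs_weight L \<beta> \<phi>)" for i j
    by (rule int[of "\<lambda>v. (v $ i)\<^sup>2 * (v $ j)\<^sup>2"]) (use c1 in \<open>auto intro!: mult_le_one simp: abs_mult abs_square_le_1\<close>)
  have int2: "integrable ?M (\<lambda>\<phi>. (\<phi> x $ i)\<^sup>2 * gibbs_weight L \<beta> \<phi>)" for i
    by (rule int[of "\<lambda>v. (v $ i)\<^sup>2"]) (use c1 in \<open>auto simp: abs_square_le_1\<close>)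
  have int0: "integrable ?M (gibbs_weight L \<beta>)"
    using int[of "\<lambda>_. 1"] by simp
  have inv: "E (\<lambda>v. g (R v)) = E g" if "orthogonal_transformation R" "g \<in> borel_measurable borel" for R g
    unfolding E_def by (rule gibbs_rotation_invariant[OF that(1) x that(2)])
  define S22 S4 S2 W where "S22 = E (\<lambda>v. (v $ a)\<^sup>2 * (v $ b)\<^sup>2)" and "S4 = E (\<lambda>v. (v $ a)\<^sup>2 * (v $ a)\<^sup>2)"
    and "S2 = E (\<lambda>v. (v $ a)\<^sup>2)" and "W = (\<integral>\<phi>. gibbs_weight L \<beta> \<phi> \<partial>?M)"
  have S4': "E (\<lambda>v. (v $ b)\<^sup>2 * (v $ b)\<^sup>2) = S4"
    unfolding S4_def using inv[OF orthogonal_coordinate_swap[of a b], of "\<lambda>v. (v $ a)\<^sup>2 * (v $ a)\<^sup>2"] by simp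
  have "S22 = E (\<lambda>v. ((v $ a)\<^sup>2 - (v $ b)\<^sup>2)\<^sup>2 / 4)"
  proof -
    have "(plane_rotation a b v $ a)\<^sup>2 * (plane_rotation a b v $ b)\<^sup>2 = ((v $ a)\<^sup>2 - (v $ b)\<^sup>2)\<^sup>2 / 4" for v
    proof -
      have "plane_rotation a b v $ a * plane_rotation a b v $ b = ((v $ a)\<^sup>2 - (v $ b)\<^sup>2) / 2"
        using ab by (simp add: plane_rotation_def power2_eq_square field_simps)
      then show ?thesis unfolding power_mult_distrib[symmetric] by (simp only: power_divide) simp
    qed
    note rot = this
    have "E (\<lambda>v. (plane_rotation a b v $ a)\<^sup>2 * (plane_rotation a b v $ b)\<^sup>2) = S22"
      unfolding S22_def by (rule inv[OF orthogonal_plane_rotation[OF ab], of "\<lambda>v. (v $ a)\<^sup>2 * (v $ b)\<^sup>2"]) measurable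
    then show ?thesis unfolding rot by simp
  qed
  also have "\<dots> = (\<integral>\<phi>. ((\<phi> x $ a)\<^sup>2 * (\<phi> x $ a)\<^sup>2 * gibbs_weight L \<beta> \<phi> + (\<phi> x $ b)\<^sup>2 * (\<phi> x $ b)\<^sup>2 * gibbs_weight L \<beta> \<phi>
      - 2 * ((\<phi> x $ a)\<^sup>2 * (\<phi> x $ b)\<^sup>2 * gibbs_weight L \<beta> \<phi>)) / 4 \<partial>?M)"
    unfolding E_def by (intro Bochner_Integration.integral_cong) (simp_all add: power2_eq_square field_simps)
  also have "\<dots> = (S4 + S4 - 2 * S22) / 4"
    using int22[of a a] int22[of b b] int22[of a b] S4' by (simp add: S4_def S22_def E_def)
  finally have S22: "3 * S22 = S4" by simp
  have S2': "E (\<lambda>v. (v $ c)\<^sup>2) = S2" for c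
    unfolding S2_def using inv[OF orthogonal_coordinate_swap[of a c], of "\<lambda>v. (v $ a)\<^sup>2"] by simp
  have "W = (\<integral>\<phi>. (\<Sum>c\<in>UNIV. (\<phi> x $ c)\<^sup>2 * gibbs_weight L \<beta> \<phi>) \<partial>?M)"
    unfolding W_def
  proof (rule integral_cong_AE)
    show "AE \<phi> in ?M. gibbs_weight L \<beta> \<phi> = (\<Sum>c\<in>UNIV. (\<phi> x $ c)\<^sup>2 * gibbs_weight L \<beta> \<phi>)"
      using AE_spin_measure
    proof eventually_elim
      case (elim \<phi>)
      have "(\<Sum>c\<in>UNIV. (\<phi> x $ c)\<^sup>2) = (norm (\<phi> x))\<^sup>2"
        by (simp add: norm_vec_def L2_set_def sum_nonneg)
      then show ?case using elim x by (simp flip: sum_distrib_right)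
    qed
  qed (use int2 int0 in auto)
  also have "\<dots> = (\<Sum>c\<in>UNIV. E (\<lambda>v. (v $ c)\<^sup>2))"
    unfolding E_def by (rule Bochner_Integration.integral_sum) (rule int2)
  finally have W: "W = N * S2" by (simp add: S2' N_def)
  \<comment> \<open>After division by \<open>W\<close> the square of a coordinate has mean
    \<open>1 / N\<close>, so this integral is its variance up to the factor
    \<open>W\<close>.\<close>
  have "0 \<le> (\<integral>\<phi>. ((\<phi> x $ a)\<^sup>2 - 1 / N)\<^sup>2 * gibbs_weight L \<beta> \<phi> \<partial>?M)"
    by (intro integral_nonneg_AE) (simp add: less_imp_le gibbs_weight_bounds[OF \<beta>])
  also have "\<dots> = (\<integral>\<phi>. (\<phi> x $ a)\<^sup>2 * (\<phi> x $ a)\<^sup>2 * gibbs_weight L \<beta> \<phi> - (2 / N) * ((\<phi> x $ a)\<^sup>2 * gibbs_weight L \<beta> \<phi>)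
      + (1 / N\<^sup>2) * gibbs_weight L \<beta> \<phi> \<partial>?M)"
    by (intro Bochner_Integration.integral_cong) (simp_all add: power2_eq_square algebra_simps)
  also have "\<dots> = S4 - (2 / N) * S2 + (1 / N\<^sup>2) * W"
    using int22[of a a] int2[of a] int0 by (simp add: S4_def S2_def E_def W_def)
  finally have "S4 \<ge> W / N\<^sup>2"
    unfolding W by (simp add: power2_eq_square N_def)
  then have "W / N\<^sup>2 / 3 \<le> S22" using S22 by simp
  then show ?thesis
    by (simp add: S22_def E_def W_def N_def power_mult_distrib mult.commute)
qed

text \<open>Testing the unit flow \<open>k\<close> from \<open>x\<close> to \<open>y\<close> on one
  spin coordinate writes the long difference as the bond sum of \<open>infrared_bound\<close> with
  \<open>e = axis a 1\<close>. The constant is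
  \<open>9\<^sup>2 / (2 * (1 / 4)) = 162\<close>.\<close>

lemma gibbs_difference_bound:
  fixes x y :: "int ^ 'd" and a :: "'n :: finite"
  assumes \<beta>: "\<beta> > 0" and L: "L > 0" "even L" and x: "x \<in> torus L" and y: "y \<in> torus L" and d: "3 \<le> CARD('d)"
  shows "(\<integral>\<phi>. (\<phi> x $ a - \<phi> y $ a)\<^sup>2 * gibbs_weight L \<beta> \<phi> \<partial>spin_measure L)
    \<le> 162 * (real CARD('d))\<^sup>2 / \<beta> * (\<integral>\<phi>. gibbs_weight L \<beta> \<phi> \<partial>(spin_measure L :: (int ^ 'd \<Rightarrow> real ^ 'n) measure))"
proof -
  let ?M = "spin_measure L :: (int ^ 'd \<Rightarrow> real ^ 'n) measure"
  obtain k where k: "\<And>f. f x - f y = (\<Sum>p\<in>torus_pairs L. k p * (f (fst p) - f (snd p)))"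
    and k2: "L2_set k (torus_pairs L) \<le> 9 * real CARD('d)"
    using has_flow_between[OF L(1) x y d] unfolding has_flow_def by blast
  interpret single_spin "\<beta> / 4" "sphere_uniform :: (real ^ 'n) measure"
    by (rule single_spin_sphere) (use \<beta> in simp)
  have "(\<Sum>p\<in>torus_pairs L. k p * ((\<phi> (fst p) - \<phi> (snd p)) \<bullet> axis a 1)) = \<phi> x $ a - \<phi> y $ a" for \<phi> :: "int ^ 'd \<Rightarrow> real ^ 'n"
    using k[of "\<lambda>z. \<phi> z $ a"] by (simp add: inner_axis)
  then have "(\<integral>\<phi>. (\<phi> x $ a - \<phi> y $ a)\<^sup>2 * gibbs_weight L \<beta> \<phi> \<partial>?M)
      \<le> (\<Sum>p\<in>torus_pairs L. (k p)\<^sup>2) / (2 * (\<beta> / 4)) * (\<integral>\<phi>. gibbs_weight L \<beta> \<phi> \<partial>?M)"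
    using infrared_bound[OF finite_torus torus_pairs_subset torus_reflection_cutting[OF L], of "axis a 1" k]
    by (simp add: gibbs_weight_def norm_axis_1)
  also have "\<dots> \<le> 81 * (real CARD('d))\<^sup>2 / (2 * (\<beta> / 4)) * (\<integral>\<phi>. gibbs_weight L \<beta> \<phi> \<partial>?M)"
  proof (intro mult_right_mono divide_right_mono)
    have "(L2_set k (torus_pairs L))\<^sup>2 \<le> (9 * real CARD('d))\<^sup>2"
      using k2 by (intro power_mono) auto
    then show "(\<Sum>p\<in>torus_pairs L. (k p)\<^sup>2) \<le> 81 * (real CARD('d))\<^sup>2"
      by (simp add: L2_set_def sum_nonneg power_mult_distrib)
    show "0 \<le> (\<integral>\<phi>. gibbs_weight L \<beta> \<phi> \<partial>?M)"
      by (intro integral_nonneg_AE) (simp add: less_imp_le gibbs_weight_bounds[OF \<beta>])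
  qed (use \<beta> in auto)
  finally show ?thesis by simp
qed

theorem theoremA1:
  assumes "3 \<le> CARD('d::finite)" and "2 \<le> CARD('n::finite)"
  shows "\<exists>\<beta>0\<ge>0. \<forall>\<beta>>\<beta>0. \<exists>c1>0. \<exists>c2>0. \<forall>L::nat. 0 < L \<and> even L \<longrightarrow>
    (\<forall>x \<in> torus L :: (int ^ 'd) set. \<forall>y \<in> torus L.
      infnorm_int (torus_rep L (x - y)) \<le> c2 * real L \<longrightarrow>
      (\<forall>a b :: 'n. a \<noteq> b \<longrightarrow>
        c1 \<le> spin_expectation L \<beta> (\<lambda>\<phi>. \<phi> x $ a * \<phi> x $ b * \<phi> y $ a * \<phi> y $ b)))"
proof -
  define N where "N = real CARD('n)"
  define D where "D = real CARD('d)"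
  have N0: "N > 0" by (simp add: N_def)
  have bound: "1 / (6 * N\<^sup>2) \<le> spin_expectation L \<beta> (\<lambda>\<phi>. \<phi> x $ a * \<phi> x $ b * \<phi> y $ a * \<phi> y $ b)"
    if \<beta>: "\<beta> > 1944 * D\<^sup>2 * N\<^sup>2" and L: "0 < L" "even L" and x: "x \<in> torus L" and y: "y \<in> torus L" and ab: "a \<noteq> b"
    for \<beta> L and x y :: "int ^ 'd" and a b :: 'n
  proof -
    have \<beta>0: "\<beta> > 0" by (rule le_less_trans[OF _ \<beta>]) simp
    let ?M = "spin_measure L :: (int ^ 'd \<Rightarrow> real ^ 'n) measure"
    let ?g = "gibbs_weight L \<beta> :: (int ^ 'd \<Rightarrow> real ^ 'n) \<Rightarrow> real"
    define F where "F z \<phi> = \<phi> z $ a * \<phi> z $ b" for z and \<phi> :: "int ^ 'd \<Rightarrow> real ^ 'n"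
    define W where "W = integral\<^sup>L ?M ?g"
    have comp [measurable]: "(\<lambda>\<phi>. \<phi> z $ i) \<in> borel_measurable ?M" if "z \<in> torus L" for z i
      using measurable_compose[OF measurable_spin_torus[OF that] borel_measurable_nth[of i]] by simp
    have c1: "\<bar>\<phi> z $ i\<bar> \<le> 1" if "\<forall>z\<in>torus L. norm (\<phi> z) = 1" "z \<in> torus L" for \<phi> :: "int ^ 'd \<Rightarrow> real ^ 'n" and z i
      using component_le_norm_cart[of "\<phi> z" i] that by simp
    have F1: "\<bar>F z \<phi>\<bar> \<le> 1" if "\<forall>z\<in>torus L. norm (\<phi> z) = 1" "z \<in> torus L" for z \<phi>
      unfolding F_def abs_mult using c1[OF that] by (intro mult_le_one) auto
    have F_meas [measurable]: "F z \<in> borel_measurable ?M" if "z \<in> torus L" for z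
      unfolding F_def using comp[OF that] by measurable
    note [measurable] = F_meas[OF x] F_meas[OF y] comp[OF x] comp[OF y]
    have W_pos: "W > 0"
      using single_spin.integral_weight_pos[OF single_spin_sphere[of "\<beta> / 4"] torus_pairs_subset[of L], of "\<lambda>_. 0"] \<beta>0
      unfolding W_def gibbs_weight_def[abs_def] by simp
    have intFF: "integrable ?M (\<lambda>\<phi>. F z \<phi> * F z' \<phi> * ?g \<phi>)" if "z \<in> torus L" "z' \<in> torus L" for z z'
    proof (rule integrable_gibbs[OF \<beta>0, of _ _ 1])
      show "(\<lambda>\<phi>. F z \<phi> * F z' \<phi>) \<in> borel_measurable ?M"
        using F_meas[OF that(1)] F_meas[OF that(2)] by measurable
      show "\<bar>F z \<phi> * F z' \<phi>\<bar> \<le> 1" if "\<forall>z\<in>torus L. norm (\<phi> z) = 1" for \<phi>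
        unfolding abs_mult using F1[OF that] \<open>z \<in> torus L\<close> \<open>z' \<in> torus L\<close> by (intro mult_le_one) auto
    qed
    have intD: "integrable ?M (\<lambda>\<phi>. (\<phi> x $ i - \<phi> y $ i)\<^sup>2 * ?g \<phi>)" for i
    proof (rule integrable_gibbs[OF \<beta>0, of _ _ "2\<^sup>2"])
      show "\<bar>(\<phi> x $ i - \<phi> y $ i)\<^sup>2\<bar> \<le> 2\<^sup>2" if "\<forall>z\<in>torus L. norm (\<phi> z) = 1" for \<phi> :: "int ^ 'd \<Rightarrow> real ^ 'n"
      proof -
        have "\<bar>\<phi> x $ i - \<phi> y $ i\<bar> \<le> 2"
          using c1[OF that x, of i] c1[OF that y, of i] by linarith
        from power_mono[OF this, of 2] show ?thesis by simp
      qed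
    qed measurable
    \<comment> \<open>Polarization: \<open>F x * F y\<close> is the mean of the two squares minus
      half of \<open>(F x - F y)\<^sup>2\<close>. As coordinates are at most 1 in absolute value,
      \<open>F x - F y\<close> is at most the sum of the two coordinate differences in absolute
      value, and squaring that sum costs a factor 2 which the half absorbs.\<close>
    have "(1 / 2) * (\<integral>\<phi>. F x \<phi> * F x \<phi> * ?g \<phi> \<partial>?M) + (1 / 2) * (\<integral>\<phi>. F y \<phi> * F y \<phi> * ?g \<phi> \<partial>?M)
        - ((\<integral>\<phi>. (\<phi> x $ a - \<phi> y $ a)\<^sup>2 * ?g \<phi> \<partial>?M) + (\<integral>\<phi>. (\<phi> x $ b - \<phi> y $ b)\<^sup>2 * ?g \<phi> \<partial>?M))
      = (\<integral>\<phi>. (1 / 2) * (F x \<phi> * F x \<phi> * ?g \<phi>) + (1 / 2) * (F y \<phi> * F y \<phi> * ?g \<phi>)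
        - ((\<phi> x $ a - \<phi> y $ a)\<^sup>2 * ?g \<phi> + (\<phi> x $ b - \<phi> y $ b)\<^sup>2 * ?g \<phi>) \<partial>?M)"
      using intFF[OF x x] intFF[OF y y] intD by simp
    also have "\<dots> \<le> (\<integral>\<phi>. F x \<phi> * F y \<phi> * ?g \<phi> \<partial>?M)"
    proof (rule integral_mono_AE)
      show "AE \<phi> in ?M. (1 / 2) * (F x \<phi> * F x \<phi> * ?g \<phi>) + (1 / 2) * (F y \<phi> * F y \<phi> * ?g \<phi>)
        - ((\<phi> x $ a - \<phi> y $ a)\<^sup>2 * ?g \<phi> + (\<phi> x $ b - \<phi> y $ b)\<^sup>2 * ?g \<phi>) \<le> F x \<phi> * F y \<phi> * ?g \<phi>"
        using AE_spin_measure
      proof eventually_elim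
        case (elim \<phi>)
        note n = this
        have "\<bar>F x \<phi> - F y \<phi>\<bar> = \<bar>(\<phi> x $ a - \<phi> y $ a) * \<phi> x $ b + \<phi> y $ a * (\<phi> x $ b - \<phi> y $ b)\<bar>"
          by (simp add: F_def algebra_simps)
        also have "\<dots> \<le> \<bar>\<phi> x $ a - \<phi> y $ a\<bar> * \<bar>\<phi> x $ b\<bar> + \<bar>\<phi> y $ a\<bar> * \<bar>\<phi> x $ b - \<phi> y $ b\<bar>"
          by (metis abs_mult abs_triangle_ineq)
        also have "\<dots> \<le> \<bar>\<phi> x $ a - \<phi> y $ a\<bar> * 1 + 1 * \<bar>\<phi> x $ b - \<phi> y $ b\<bar>"
          using c1[OF n x, of b] c1[OF n y, of a] by (intro add_mono mult_left_mono mult_right_mono) auto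
        finally have "(F x \<phi> - F y \<phi>)\<^sup>2 \<le> (\<bar>\<phi> x $ a - \<phi> y $ a\<bar> + \<bar>\<phi> x $ b - \<phi> y $ b\<bar>)\<^sup>2"
          by (intro abs_le_square_iff[THEN iffD1]) simp
        also have "\<dots> \<le> 2 * ((\<phi> x $ a - \<phi> y $ a)\<^sup>2 + (\<phi> x $ b - \<phi> y $ b)\<^sup>2)"
          using sum_squares_bound[of "\<bar>\<phi> x $ a - \<phi> y $ a\<bar>" "\<bar>\<phi> x $ b - \<phi> y $ b\<bar>"]
          by (simp add: power2_sum)
        finally have "(1 / 2) * (F x \<phi> * F x \<phi>) + (1 / 2) * (F y \<phi> * F y \<phi>)
            - ((\<phi> x $ a - \<phi> y $ a)\<^sup>2 + (\<phi> x $ b - \<phi> y $ b)\<^sup>2) \<le> F x \<phi> * F y \<phi>"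
          by (simp add: power2_diff power2_eq_square[of "F x \<phi>"] power2_eq_square[of "F y \<phi>"])
        from mult_right_mono[OF this less_imp_le[OF gibbs_weight_bounds(1)[OF \<beta>0, of L \<phi>]]]
        show ?case by (simp add: algebra_simps)
      qed
    qed (use intFF[OF x x] intFF[OF y y] intFF[OF x y] intD in auto)
    finally have "(1 / 2) * (\<integral>\<phi>. F x \<phi> * F x \<phi> * ?g \<phi> \<partial>?M) + (1 / 2) * (\<integral>\<phi>. F y \<phi> * F y \<phi> * ?g \<phi> \<partial>?M)
        - ((\<integral>\<phi>. (\<phi> x $ a - \<phi> y $ a)\<^sup>2 * ?g \<phi> \<partial>?M) + (\<integral>\<phi>. (\<phi> x $ b - \<phi> y $ b)\<^sup>2 * ?g \<phi> \<partial>?M))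
      \<le> (\<integral>\<phi>. F x \<phi> * F y \<phi> * ?g \<phi> \<partial>?M)" .
    moreover have "W / (3 * N\<^sup>2) \<le> (\<integral>\<phi>. F z \<phi> * F z \<phi> * ?g \<phi> \<partial>?M)" if "z \<in> torus L" for z
      using gibbs_square_lower_bound[OF \<beta>0 that ab] by (simp add: W_def N_def F_def power2_eq_square)
    note this[OF x] this[OF y]
    moreover have "(\<integral>\<phi>. (\<phi> x $ i - \<phi> y $ i)\<^sup>2 * ?g \<phi> \<partial>?M) \<le> 162 * D\<^sup>2 / \<beta> * W" for i
      unfolding W_def D_def by (rule gibbs_difference_bound[OF \<beta>0 L x y assms(1)])
    note this[of a] this[of b]
    ultimately have "W / (3 * N\<^sup>2) - 324 * D\<^sup>2 / \<beta> * W \<le> (\<integral>\<phi>. F x \<phi> * F y \<phi> * ?g \<phi> \<partial>?M)"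
      by (simp add: field_simps)
    moreover have "324 * D\<^sup>2 / \<beta> \<le> 1 / (6 * N\<^sup>2)"
      using \<beta> \<beta>0 N0 by (simp add: field_simps)
    then have "324 * D\<^sup>2 / \<beta> * W \<le> 1 / (6 * N\<^sup>2) * W"
      using W_pos by (intro mult_right_mono) auto
    ultimately have "1 / (6 * N\<^sup>2) * W \<le> (\<integral>\<phi>. F x \<phi> * F y \<phi> * ?g \<phi> \<partial>?M)"
      by (simp add: field_simps)
    then have "1 / (6 * N\<^sup>2) \<le> (\<integral>\<phi>. F x \<phi> * F y \<phi> * ?g \<phi> \<partial>?M) / W"
      using W_pos by (simp add: pos_le_divide_eq)
    also have "\<dots> = spin_expectation L \<beta> (\<lambda>\<phi>. F x \<phi> * F y \<phi>)"
      unfolding W_def by (rule spin_expectation_eq_gibbs[symmetric]) measurable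
    finally show ?thesis by (simp add: F_def mult_ac)
  qed
  show ?thesis
  proof (rule exI[of _ "1944 * D\<^sup>2 * N\<^sup>2"], intro conjI allI impI)
    fix \<beta> assume "\<beta> > 1944 * D\<^sup>2 * N\<^sup>2"
    with bound N0 show "\<exists>c1>0. \<exists>c2>0. \<forall>L::nat. 0 < L \<and> even L \<longrightarrow>
      (\<forall>x \<in> torus L :: (int ^ 'd) set. \<forall>y \<in> torus L.
        infnorm_int (torus_rep L (x - y)) \<le> c2 * real L \<longrightarrow>
        (\<forall>a b :: 'n. a \<noteq> b \<longrightarrow>
          c1 \<le> spin_expectation L \<beta> (\<lambda>\<phi>. \<phi> x $ a * \<phi> x $ b * \<phi> y $ a * \<phi> y $ b)))"
      by (intro exI[of _ "1 / (6 * N\<^sup>2)"] exI[of _ 1] conjI) auto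
  qed simp
qed

end
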